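(* Let $P,Q\in\mathbb Z$ with $Q\ne0$, $f(t)=t^2-Pt+Q$ with roots $\theta_1,\theta_2$, $D=P^2-4Q\neq0$, and let $p$ be a prime with $p\nmid Q$; write $D=p^sD_0$ with $s\ge0$, $p\nmid D_0$. For $R\in\{\mathbb Q,\mathbb Z_{(p)},\mathbb F_p\}$ let $G_R(f)$ be as in the context, with classes written $[w_1:w_0]$. (1) If $f$ is irreducible over $\mathbb Q$, then $G_{\mathbb Q}(f)\xrightarrow{\sim}\mathbb Q(\theta_1)^{\times}/\mathbb Q^{\times}$, $[w_1:w_0]\mapsto w_1-w_0\theta_1\bmod\mathbb Q^{\times}$. If $f$ is reducible over $\mathbb Q$, then $G_{\mathbb Q}(f)\xrightarrow{\sim}\mathbb Q^{\times}$, $[w_1:w_0]\mapsto(w_1-w_0\theta_1)(w_1-w_0\theta_2)^{-1}$. (2) If $f$ is irreducible over $\mathbb Q$, then $G_{\mathbb Z_{(p)}}(f)\xrightarrow{\sim}\mathbb Z_{(p)}[\theta_1]^{\times}/\mathbb Z_{(p)}^{\times}$, $[w_1:w_0]\mapsto w_1-w_0\theta_1\bmod\mathbb Z_{(p)}^{\times}$. If $f$ is reducible over $\mathbb Q$, then $G_{\mathbb Z_{(p)}}(f)$ is isomorphic to $\mathbb Z_{(p)}^{\times}$ if $p\nmid D$ and to $1+p^{s/2}\mathbb Z_{(p)}$ if $p\mid D$, via $[w_1:w_0]\mapsto(w_1-w_0\theta_1)(w_1-w_0\theta_2)^{-1}$. (3)(i) If $f\bmod p$ is irreducible over $\mathbb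 F_p$, then $G_{\mathbb F_p}(f)\xrightarrow{\sim}\mathbb F_p(\theta_1)^{\times}/\mathbb F_p^{\times}$, $[w_1:w_0]\mapsto w_1-w_0\theta_1\bmod\mathbb F_p^{\times}$. (ii) If $f\bmod p$ is reducible over $\mathbb F_p$: if $p\nmid D$, then $G_{\mathbb F_p}(f)\xrightarrow{\sim}\mathbb F_p^{\times}$, $[w_1:w_0]\mapsto(w_1-w_0\theta_1)(w_1-w_0\theta_2)^{-1}$; if $p\mid D$, then $G_{\mathbb F_p}(f)\xrightarrow{\sim}\mathbb F_p$ (additive group), $[w_1:w_0]\mapsto -w_0(w_1-w_0\theta)^{-1}$, where $\theta$ is the double root of $f\bmod p$.
   Context: For an integral domain $R$ in which $Q$ is a unit (with $P,Q$ mapped into $R$), let $\mathscr S(f,R)^{\times}$ be the set of sequences $(w_n)_{n\in\mathbb Z}$ in $R$ with $w_{n+2}-Pw_{n+1}+Qw_n=0$ for all $n$ and $\Lambda(w_1,w_0):=w_1^2-Pw_0w_1+Qw_0^2\in R^{\times}$. It is an abelian group with product $(w_n)*(v_n)=(u_n)$ determined by $u_1=w_1v_1-Qw_0v_0$, $u_0=w_0v_1+w_1v_0-Pw_0v_0$ (this is the multiplication of $(R[t]/(f))^{\times}$ under $(w_n)\mapsto w_1-w_0t$). Two sequences are equivalent, ${\bf w}\sim{\bf v}$, if $w_n=\lambda v_n$ for all $n$ for some $\lambda\in R^{\times}$; $G_R(f):=\mathscr S(f,R)^{\times}/\sim$ with the induced group structure, and $[w_1:w_0]$ denotes the class of the sequence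 with initial terms $w_1,w_0$. For $R=\mathbb F_p$, $P,Q,\theta_i$ are reduced mod $p$. For reducible $f$ over $\mathbb Q$, $\theta_1,\theta_2\in\mathbb Z$. *)

theory Defs
  imports "HOL-Algebra.Algebra" "HOL-Algebra.Algebraic_Closure_Type" "HOL-Number_Theory.Residues" Complex_Main
begin

text \<open>
  Throughout, integers are mapped into a ring \<open>R\<close> by \<open>n \<mapsto> [n] \<cdot>\<^bsub>R\<^esub> \<one>\<^bsub>R\<^esub>\<close>. Polynomials are coefficient
  lists, leading coefficient first, so this is \<open>t\<^sup>2 - P t + Q\<close>.
\<close>
definition quad_poly :: "('a, 'm) ring_scheme \<Rightarrow> int \<Rightarrow> int \<Rightarrow> 'a list" where
  "quad_poly R P Q = [\<one>\<^bsub>R\<^esub>, \<ominus>\<^bsub>R\<^esub> ([P] \<cdot>\<^bsub>R\<^esub> \<one>\<^bsub>R\<^esub>), [Q] \<cdot>\<^bsub>R\<^esub> \<one>\<^bsub>R\<^esub>]"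

definition quad_irreducible :: "('a, 'm) ring_scheme \<Rightarrow> int \<Rightarrow> int \<Rightarrow> bool" where
  "quad_irreducible R P Q \<longleftrightarrow> pirreducible\<^bsub>R\<^esub> (carrier R) (quad_poly R P Q)"

text \<open>\<open>\<alpha>, \<beta>\<close> are the roots in \<open>R\<close>, with multiplicity: \<open>f = (t - \<alpha>) (t - \<beta>)\<close> in \<open>R[t]\<close>.\<close>
definition quad_roots :: "('a, 'm) ring_scheme \<Rightarrow> int \<Rightarrow> int \<Rightarrow> 'a \<Rightarrow> 'a \<Rightarrow> bool" where
  "quad_roots R P Q \<alpha> \<beta> \<longleftrightarrow> \<alpha> \<in> carrier R \<and> \<beta> \<in> carrier R \<and>
     quad_poly R P Q = [\<one>\<^bsub>R\<^esub>, \<ominus>\<^bsub>R\<^esub> \<alpha>] \<otimes>\<^bsub>univ_poly R (carrier R)\<^esub> [\<one>\<^bsub>R\<^esub>, \<ominus>\<^bsub>R\<^esub> \<beta>]"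

definition rec_seqs :: "('a, 'm) ring_scheme \<Rightarrow> int \<Rightarrow> int \<Rightarrow> (int \<Rightarrow> 'a) set" where
  "rec_seqs R P Q = {w. (\<forall>n. w n \<in> carrier R) \<and>
     (\<forall>n. w (n + 2) \<ominus>\<^bsub>R\<^esub> ([P] \<cdot>\<^bsub>R\<^esub> \<one>\<^bsub>R\<^esub>) \<otimes>\<^bsub>R\<^esub> w (n + 1) \<oplus>\<^bsub>R\<^esub> ([Q] \<cdot>\<^bsub>R\<^esub> \<one>\<^bsub>R\<^esub>) \<otimes>\<^bsub>R\<^esub> w n = \<zero>\<^bsub>R\<^esub>)}"

text \<open>The arguments are, in this order, the terms at \<open>1\<close> and at \<open>0\<close>.\<close>
definition seq_of :: "('a, 'm) ring_scheme \<Rightarrow> int \<Rightarrow> int \<Rightarrow> 'a \<Rightarrow> 'a \<Rightarrow> (int \<Rightarrow> 'a)" where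
  "seq_of R P Q a b = (THE w. w \<in> rec_seqs R P Q \<and> w 1 = a \<and> w 0 = b)"

definition Lam :: "('a, 'm) ring_scheme \<Rightarrow> int \<Rightarrow> int \<Rightarrow> 'a \<Rightarrow> 'a \<Rightarrow> 'a" where
  "Lam R P Q a b = a \<otimes>\<^bsub>R\<^esub> a \<ominus>\<^bsub>R\<^esub> ([P] \<cdot>\<^bsub>R\<^esub> \<one>\<^bsub>R\<^esub>) \<otimes>\<^bsub>R\<^esub> b \<otimes>\<^bsub>R\<^esub> a \<oplus>\<^bsub>R\<^esub> ([Q] \<cdot>\<^bsub>R\<^esub> \<one>\<^bsub>R\<^esub>) \<otimes>\<^bsub>R\<^esub> (b \<otimes>\<^bsub>R\<^esub> b)"

definition seq_group :: "('a, 'm) ring_scheme \<Rightarrow> int \<Rightarrow> int \<Rightarrow> (int \<Rightarrow> 'a) monoid" where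
  "seq_group R P Q =
     \<lparr>carrier = {w \<in> rec_seqs R P Q. Lam R P Q (w 1) (w 0) \<in> Units R},
      monoid.mult = (\<lambda>w v. seq_of R P Q
        (w 1 \<otimes>\<^bsub>R\<^esub> v 1 \<ominus>\<^bsub>R\<^esub> ([Q] \<cdot>\<^bsub>R\<^esub> \<one>\<^bsub>R\<^esub>) \<otimes>\<^bsub>R\<^esub> w 0 \<otimes>\<^bsub>R\<^esub> v 0)
        (w 0 \<otimes>\<^bsub>R\<^esub> v 1 \<oplus>\<^bsub>R\<^esub> w 1 \<otimes>\<^bsub>R\<^esub> v 0 \<ominus>\<^bsub>R\<^esub> ([P] \<cdot>\<^bsub>R\<^esub> \<one>\<^bsub>R\<^esub>) \<otimes>\<^bsub>R\<^esub> w 0 \<otimes>\<^bsub>R\<^esub> v 0)),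
      one = seq_of R P Q \<one>\<^bsub>R\<^esub> \<zero>\<^bsub>R\<^esub>\<rparr>"

definition seq_equiv :: "('a, 'm) ring_scheme \<Rightarrow> int \<Rightarrow> int \<Rightarrow> ((int \<Rightarrow> 'a) \<times> (int \<Rightarrow> 'a)) set" where
  "seq_equiv R P Q = {(w, v). w \<in> carrier (seq_group R P Q) \<and> v \<in> carrier (seq_group R P Q) \<and>
     (\<exists>c \<in> Units R. \<forall>n. w n = c \<otimes>\<^bsub>R\<^esub> v n)}"

definition class_group :: "('a, 'm) ring_scheme \<Rightarrow> int \<Rightarrow> int \<Rightarrow> (int \<Rightarrow> 'a) set monoid" where
  "class_group R P Q =
     \<lparr>carrier = carrier (seq_group R P Q) // seq_equiv R P Q,
      monoid.mult = (\<lambda>A B. \<Union>w \<in> A. \<Union>v \<in> B. seq_equiv R P Q `` {w \<otimes>\<^bsub>seq_group R P Q\<^esub> v}),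
      one = seq_equiv R P Q `` {\<one>\<^bsub>seq_group R P Q\<^esub>}\<rparr>"

text \<open>The class \<open>[a : b]\<close>.\<close>
definition seq_class :: "('a, 'm) ring_scheme \<Rightarrow> int \<Rightarrow> int \<Rightarrow> 'a \<Rightarrow> 'a \<Rightarrow> (int \<Rightarrow> 'a) set" where
  "seq_class R P Q a b = seq_equiv R P Q `` {seq_of R P Q a b}"

text \<open>\<open>[w\<^sub>1 : w\<^sub>0] \<mapsto> g w\<^sub>1 w\<^sub>0\<close> is well defined and an isomorphism of \<open>G\<^sub>R(f)\<close> onto \<open>H\<close>.\<close>
definition class_iso_via ::
  "('a, 'm) ring_scheme \<Rightarrow> int \<Rightarrow> int \<Rightarrow> ('b, 'n) monoid_scheme \<Rightarrow> ('a \<Rightarrow> 'a \<Rightarrow> 'b) \<Rightarrow> bool" where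
  "class_iso_via R P Q H g \<longleftrightarrow>
     (\<exists>\<phi> \<in> iso (class_group R P Q) H.
        \<forall>a \<in> carrier R. \<forall>b \<in> carrier R.
          Lam R P Q a b \<in> Units R \<longrightarrow> \<phi> (seq_class R P Q a b) = g a b)"

text \<open>For subrings \<open>B \<subseteq> A\<close> of \<open>L\<close>: the quotient \<open>A\<^sup>\<times> / B\<^sup>\<times>\<close>, and the class of \<open>x \<in> A\<^sup>\<times>\<close> in it.\<close>
definition unit_quot :: "('a, 'm) ring_scheme \<Rightarrow> 'a set \<Rightarrow> 'a set \<Rightarrow> 'a set monoid" where
  "unit_quot L A B = units_of (L\<lparr>carrier := A\<rparr>) Mod Units (L\<lparr>carrier := B\<rparr>)"

definition unit_coset :: "('a, 'm) ring_scheme \<Rightarrow> 'a set \<Rightarrow> 'a set \<Rightarrow> 'a \<Rightarrow> 'a set" where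
  "unit_coset L A B x = Units (L\<lparr>carrier := B\<rparr>) #>\<^bsub>units_of (L\<lparr>carrier := A\<rparr>)\<^esub> x"

abbreviation complex_ring :: "complex ring" where
  "complex_ring \<equiv> ring_of_type_algebra"

text \<open>\<open>\<rat>\<close> and \<open>\<int>\<^sub>(\<^sub>p\<^sub>)\<close> are taken as subrings of \<open>\<complex>\<close>, where the roots of \<open>f\<close> live.\<close>
definition rat_ring :: "complex ring" where
  "rat_ring = complex_ring\<lparr>carrier := \<rat>\<rparr>"

definition Z_loc :: "nat \<Rightarrow> complex set" where
  "Z_loc p = {of_int a / of_int b | a b :: int. \<not> int p dvd b}"

definition Z_loc_ring :: "nat \<Rightarrow> complex ring" where
  "Z_loc_ring p = complex_ring\<lparr>carrier := Z_loc p\<rparr>"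

abbreviation residue_field :: "nat \<Rightarrow> int ring" where
  "residue_field p \<equiv> residue_ring (int p)"

end

theory Submission
  imports Defs
begin

text \<open>
  A sequence is determined by \<open>(w\<^sub>1, w\<^sub>0)\<close>, so \<open>G\<^sub>R(f)\<close> is the set of pairs \<open>(a, b)\<close> of unit norm
  \<open>\<Lambda>(a, b)\<close>, up to \<open>R\<^sup>\<times>\<close>, with the multiplication of \<open>a - b t\<close> in \<open>R[t]/(f)\<close>. If \<open>\<alpha>\<close> is a root
  of \<open>f\<close> in an extension \<open>L\<close> of \<open>R\<close> with \<open>1, \<alpha>\<close> independent over \<open>R\<close>, then \<open>a - b \<alpha>\<close> is a unit of
  \<open>R[\<alpha>]\<close> exactly if \<open>\<Lambda>(a, b)\<close> is a unit of \<open>R\<close>, by multiplicativity of \<open>\<Lambda>\<close> and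
  \<open>(a - b \<alpha>) (a - b P + b \<alpha>) = \<Lambda>(a, b)\<close>. If \<open>f = (t - \<alpha>) (t - \<beta>)\<close> over \<open>R\<close>, then
  \<open>\<Lambda>(a, b) = (a - b \<alpha>) (a - b \<beta>)\<close>; scaling \<open>a - b \<beta>\<close> to \<open>1\<close>, the quotient of the two factors is
  \<open>1 + (\<beta> - \<alpha>) b\<close>, which for \<open>\<alpha> \<noteq> \<beta>\<close> determines the class and runs through the units congruent
  to \<open>1\<close> modulo \<open>\<beta> - \<alpha>\<close>. Over \<open>\<int>\<^sub>(\<^sub>p\<^sub>)\<close>, \<open>(\<beta> - \<alpha>)\<^sup>2 = D\<close> makes this modulus \<open>p\<^bsup>s/2\<^esup>\<close>. For a double
  root \<open>\<alpha> = \<beta>\<close>, \<open>- b / (a - b \<alpha>)\<close> takes the place of the quotient, as the slope of \<open>a - b t\<close> at \<open>\<alpha>\<close>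
  relative to its value.
\<close>

section \<open>Recurrence sequences and the class group\<close>

lemma (in ring) eq_by_diff:
  "x \<ominus> y = \<zero> \<Longrightarrow> x \<in> carrier R \<Longrightarrow> y \<in> carrier R \<Longrightarrow> x = y"
  using r_right_minus_eq by blast

text \<open>Invertibility of \<open>Q\<close> lets the recurrence run backwards, so that a two-sided
  sequence corresponds to its pair \<open>(w 1, w 0)\<close>.\<close>

locale quad_ring = cring R for R (structure) +
  fixes P Q :: int
  assumes Q_unit: "[Q] \<cdot> \<one> \<in> Units R"
begin

abbreviation P_ring where "P_ring \<equiv> [P] \<cdot> \<one>"
abbreviation Q_ring where "Q_ring \<equiv> [Q] \<cdot> \<one>"

text \<open>Reducing \<open>(a - b t) (c - d t)\<close> by \<open>t^2 = P t - Q\<close> gives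
  \<open>prod1 - prod0 t\<close>. Working with these coordinates avoids constructing the quotient
  ring \<open>R[t]/(f)\<close>.\<close>

abbreviation prod1 where
  "prod1 a b c d \<equiv> a \<otimes> c \<ominus> Q_ring \<otimes> b \<otimes> d"
abbreviation prod0 where
  "prod0 a b c d \<equiv> b \<otimes> c \<oplus> a \<otimes> d \<ominus> P_ring \<otimes> b \<otimes> d"

lemma P_ring_closed: "P_ring \<in> carrier R" and Q_ring_closed: "Q_ring \<in> carrier R"
  by auto

section \<open>The norm form and the product in coordinates\<close>

lemma Lam_closed [simp]:
  "a \<in> carrier R \<Longrightarrow> b \<in> carrier R \<Longrightarrow> Lam R P Q a b \<in> carrier R"
  by (simp add: Lam_def)

lemma Lam_one_zero: "Lam R P Q \<one> \<zero> = \<one>"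
  by (simp add: Lam_def a_minus_def)

text \<open>\<open>Lam R P Q a b\<close> is the norm of \<open>a - b t\<close> from
  \<open>R[t]/(f)\<close> to \<open>R\<close>, and norms are multiplicative. The proof is a direct
  polynomial identity, split up so that each piece stays small.\<close>

lemma Lam_prod:
  assumes abcd [simp]: "a \<in> carrier R" "b \<in> carrier R" "c \<in> carrier R" "d \<in> carrier R"
  shows "Lam R P Q (prod1 a b c d) (prod0 a b c d) = Lam R P Q a b \<otimes> Lam R P Q c d"
proof -
  define p where "p = P_ring"
  define q where "q = Q_ring"
  \<comment> \<open>Multiplication by \<open>a - b t\<close> sends \<open>(c, d)\<close> to
    \<open>(a c - m d, b c + e d)\<close>, a linear map of determinant \<open>N\<close>.
    Substituting this into the norm form gives a quadratic form in \<open>c\<close>,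
    \<open>d\<close>, whose coefficients at \<open>c^2\<close>, \<open>c d\<close>,
    \<open>d^2\<close> turn out to be \<open>N\<close>, \<open>- p N\<close>,
    \<open>q N\<close>.\<close>
  define e where "e = a \<ominus> p \<otimes> b"
  define m where "m = q \<otimes> b"
  define N where "N = a \<otimes> a \<ominus> p \<otimes> b \<otimes> a \<oplus> q \<otimes> (b \<otimes> b)"
  have pq [simp]: "p \<in> carrier R" "q \<in> carrier R" by (auto simp: p_def q_def)
  have em [simp]: "e \<in> carrier R" "m \<in> carrier R" "N \<in> carrier R"
    by (auto simp: e_def m_def N_def)
  let ?X = "a \<otimes> c \<ominus> m \<otimes> d" and ?Y = "b \<otimes> c \<oplus> e \<otimes> d"
  have X: "prod1 a b c d = ?X" by (simp add: m_def q_def)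
  have Y: "prod0 a b c d = ?Y"
    unfolding p_def[symmetric] e_def using abcd pq by algebra
  have XX: "?X \<otimes> ?X = (c \<otimes> c) \<otimes> (a \<otimes> a) \<oplus> (c \<otimes> d) \<otimes> (\<ominus> (a \<otimes> m \<oplus> a \<otimes> m)) \<oplus> (d \<otimes> d) \<otimes> (m \<otimes> m)"
    using abcd em by algebra
  have pYX: "p \<otimes> ?Y \<otimes> ?X = (c \<otimes> c) \<otimes> (p \<otimes> b \<otimes> a) \<oplus> (c \<otimes> d) \<otimes> (p \<otimes> (a \<otimes> e \<ominus> b \<otimes> m)) \<oplus> (d \<otimes> d) \<otimes> (\<ominus> (p \<otimes> (e \<otimes> m)))"
    using abcd em pq by algebra
  have qYY: "q \<otimes> (?Y \<otimes> ?Y) = (c \<otimes> c) \<otimes> (q \<otimes> (b \<otimes> b)) \<oplus> (c \<otimes> d) \<otimes> (q \<otimes> (b \<otimes> e \<oplus> b \<otimes> e)) \<oplus> (d \<otimes> d) \<otimes> (q \<otimes> (e \<otimes> e))"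
    using abcd em pq by algebra
  have collect: "(u \<otimes> x1 \<oplus> v \<otimes> y1 \<oplus> w \<otimes> z1) \<ominus> (u \<otimes> x2 \<oplus> v \<otimes> y2 \<oplus> w \<otimes> z2) \<oplus> (u \<otimes> x3 \<oplus> v \<otimes> y3 \<oplus> w \<otimes> z3)
      = u \<otimes> (x1 \<ominus> x2 \<oplus> x3) \<oplus> v \<otimes> (y1 \<ominus> y2 \<oplus> y3) \<oplus> w \<otimes> (z1 \<ominus> z2 \<oplus> z3)"
    if "u \<in> carrier R" "v \<in> carrier R" "w \<in> carrier R" "x1 \<in> carrier R" "x2 \<in> carrier R" "x3 \<in> carrier R"
      "y1 \<in> carrier R" "y2 \<in> carrier R" "y3 \<in> carrier R" "z1 \<in> carrier R" "z2 \<in> carrier R" "z3 \<in> carrier R"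
    for u v w x1 x2 x3 y1 y2 y3 z1 z2 z3
    using that by algebra
  have coeff1: "\<ominus> (a \<otimes> m \<oplus> a \<otimes> m) \<ominus> p \<otimes> (a \<otimes> e \<ominus> b \<otimes> m) \<oplus> q \<otimes> (b \<otimes> e \<oplus> b \<otimes> e) = \<ominus> (p \<otimes> N)"
    unfolding N_def e_def m_def using abcd pq by algebra
  have coeff0: "m \<otimes> m \<ominus> \<ominus> (p \<otimes> (e \<otimes> m)) \<oplus> q \<otimes> (e \<otimes> e) = q \<otimes> N"
    unfolding N_def e_def m_def using abcd pq by algebra
  have "?X \<otimes> ?X \<ominus> p \<otimes> ?Y \<otimes> ?X \<oplus> q \<otimes> (?Y \<otimes> ?Y)
      = (c \<otimes> c) \<otimes> N \<oplus> (c \<otimes> d) \<otimes> (\<ominus> (p \<otimes> N)) \<oplus> (d \<otimes> d) \<otimes> (q \<otimes> N)"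
    unfolding XX pYX qYY by (subst collect) (simp_all only: coeff1 coeff0 N_def[symmetric], simp_all)
  also have "\<dots> = N \<otimes> (c \<otimes> c \<ominus> p \<otimes> d \<otimes> c \<oplus> q \<otimes> (d \<otimes> d))"
    using abcd pq em by algebra
  finally show ?thesis
    unfolding X Y unfolding Lam_def p_def[symmetric] q_def[symmetric] N_def .
qed

lemma Lam_scale:
  assumes [simp]: "a \<in> carrier R" "b \<in> carrier R" "c \<in> carrier R"
  shows "Lam R P Q (c \<otimes> a) (c \<otimes> b) = c \<otimes> c \<otimes> Lam R P Q a b"
proof -
  define p where "p = P_ring"
  define q where "q = Q_ring"
  have pq: "p \<in> carrier R" "q \<in> carrier R" by (auto simp: p_def q_def)
  show ?thesis unfolding Lam_def p_def[symmetric] q_def[symmetric]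
    using assms pq by algebra
qed

text \<open>Bilinearity of the product in the two pairs; this is what makes the product of classes
  independent of representatives.\<close>

lemma prod_scale:
  assumes [simp]: "a \<in> carrier R" "b \<in> carrier R" "c \<in> carrier R" "d \<in> carrier R"
    "k \<in> carrier R" "l \<in> carrier R"
  shows "prod1 (k \<otimes> a) (k \<otimes> b) (l \<otimes> c) (l \<otimes> d) = (k \<otimes> l) \<otimes> prod1 a b c d"
    and "prod0 (k \<otimes> a) (k \<otimes> b) (l \<otimes> c) (l \<otimes> d) = (k \<otimes> l) \<otimes> prod0 a b c d"
proof -
  define p where "p = P_ring"
  define q where "q = Q_ring"
  have pq: "p \<in> carrier R" "q \<in> carrier R" by (auto simp: p_def q_def)
  show "prod1 (k \<otimes> a) (k \<otimes> b) (l \<otimes> c) (l \<otimes> d) = (k \<otimes> l) \<otimes> prod1 a b c d"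
    unfolding p_def[symmetric] q_def[symmetric]
    using assms pq by algebra
  show "prod0 (k \<otimes> a) (k \<otimes> b) (l \<otimes> c) (l \<otimes> d) = (k \<otimes> l) \<otimes> prod0 a b c d"
    unfolding p_def[symmetric] q_def[symmetric]
    using assms pq by algebra
qed

section \<open>Sequences with prescribed initial terms\<close>

lemma recurrence_solve:
  assumes [simp]: "x \<in> carrier R" "y \<in> carrier R" "z \<in> carrier R"
  shows "x \<ominus> y \<oplus> z = \<zero> \<longleftrightarrow> x = y \<ominus> z"
proof -
  have "x \<ominus> y \<oplus> z = x \<ominus> (y \<ominus> z)"
    using assms by algebra
  thus ?thesis using r_right_minus_eq[of x "y \<ominus> z"] by simp
qed

lemma rec_seqs_iff:
  "w \<in> rec_seqs R P Q \<longleftrightarrow> (\<forall>n. w n \<in> carrier R) \<and>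
     (\<forall>n. w (n + 2) = P_ring \<otimes> w (n + 1) \<ominus> Q_ring \<otimes> w n)"
  by (auto simp: rec_seqs_def recurrence_solve)

text \<open>Induction in both directions on two consecutive terms. Going up, the recurrence gives
  the next term; going down, it gives \<open>Q\<close> times the previous term, and the unit
  \<open>Q\<close> cancels.\<close>

lemma rec_seqs_unique:
  assumes w: "w \<in> rec_seqs R P Q" and v: "v \<in> rec_seqs R P Q"
    and eq: "w 1 = v 1" "w 0 = v 0"
  shows "w = v"
proof
  fix n
  have w': "\<And>n. w n \<in> carrier R" "\<And>n. w (n + 2) = P_ring \<otimes> w (n + 1) \<ominus> Q_ring \<otimes> w n"
    and v': "\<And>n. v n \<in> carrier R" "\<And>n. v (n + 2) = P_ring \<otimes> v (n + 1) \<ominus> Q_ring \<otimes> v n"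
    using w v by (auto simp: rec_seqs_iff)
  have "w n = v n \<and> w (n + 1) = v (n + 1)"
  proof (induction n rule: int_induct[where k = 0])
    case base
    show ?case using eq by simp
  next
    case (step1 n)
    then show ?case using w'(2)[of n] v'(2)[of n] by (simp add: add.commute)
  next
    case (step2 n)
    have swap: "z = y \<ominus> x" if [simp]: "x \<in> carrier R" "y \<in> carrier R" "z \<in> carrier R"
      and e: "x = y \<ominus> z" for x y z
      unfolding e using that(1-3) by algebra
    have "Q_ring \<otimes> w (n - 1) = P_ring \<otimes> w n \<ominus> w (n + 1)"
      using swap[OF _ _ _ w'(2)[of "n - 1"]] w'(1) by (simp add: algebra_simps)
    moreover have "Q_ring \<otimes> v (n - 1) = P_ring \<otimes> v n \<ominus> v (n + 1)"
      using swap[OF _ _ _ v'(2)[of "n - 1"]] v'(1) by (simp add: algebra_simps)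
    ultimately have "Q_ring \<otimes> w (n - 1) = Q_ring \<otimes> v (n - 1)"
      using step2 by simp
    hence "w (n - 1) = v (n - 1)"
      using Units_l_cancel[OF Q_unit] w'(1) v'(1) by blast
    then show ?case using step2 by simp
  qed
  thus "w n = v n" ..
qed

text \<open>\<open>T\<close> moves the window \<open>(w n, w (n + 1))\<close> one place up and
  \<open>T'\<close> one place down, dividing by \<open>Q\<close>. Iterating them from the window
  \<open>(b, a)\<close> at \<open>0\<close> yields both halves of the sequence.\<close>

lemma rec_seqs_exist:
  assumes [simp]: "a \<in> carrier R" "b \<in> carrier R"
  shows "\<exists>w \<in> rec_seqs R P Q. w 1 = a \<and> w 0 = b"
proof -
  define T where "T = (\<lambda>(x, y). (y, P_ring \<otimes> y \<ominus> Q_ring \<otimes> x))"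
  define T' where "T' = (\<lambda>(x, y). (inv Q_ring \<otimes> (P_ring \<otimes> x \<ominus> y), x))"
  define C where "C = carrier R \<times> carrier R"
  have T_closed: "T s \<in> C" and T'_closed: "T' s \<in> C" if "s \<in> C" for s
    using that Q_unit by (auto simp: T_def T'_def C_def)
  \<comment> \<open>This one-sided identity is enough: it makes the downward half compatible with
    upward steps.\<close>
  have TT': "T (T' s) = s" if s: "s \<in> C" for s
  proof -
    obtain x y where xy: "s = (x, y)" and [simp]: "x \<in> carrier R" "y \<in> carrier R"
      using s by (auto simp: C_def)
    have "z \<ominus> (z \<ominus> y) = y" if [simp]: "z \<in> carrier R" for z
      using that \<open>y \<in> carrier R\<close> by algebra
    moreover have "Q_ring \<otimes> (inv Q_ring \<otimes> (P_ring \<otimes> x \<ominus> y)) = P_ring \<otimes> x \<ominus> y"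
      using Q_unit by (simp add: m_assoc[symmetric])
    ultimately show ?thesis by (simp add: xy T_def T'_def)
  qed
  define st where "st n = (if n \<ge> 0 then (T ^^ nat n) (b, a) else (T' ^^ nat (- n)) (b, a))" for n :: int
  have iter: "(T ^^ k) (b, a) \<in> C" "(T' ^^ k) (b, a) \<in> C" for k
    by (induction k) (auto simp: T_closed T'_closed, auto simp: C_def)
  have st_closed: "st n \<in> C" for n
    by (simp add: st_def iter)
  have st_step: "st (n + 1) = T (st n)" for n
  proof (cases "n \<ge> 0")
    case True
    then show ?thesis by (simp add: st_def nat_add_distrib)
  next
    case False
    hence "nat (- n) = Suc (nat (- (n + 1)))" by simp
    hence "st n = T' ((T' ^^ nat (- (n + 1))) (b, a))"
      using False by (simp add: st_def)
    \<comment> \<open>For \<open>n = -1\<close> the index \<open>n + 1\<close> falls into the other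
      branch of \<open>st\<close>; there both iterates are the zeroth.\<close>
    moreover have "st (n + 1) = (T' ^^ nat (- (n + 1))) (b, a)"
      using False by (cases "n = -1") (auto simp: st_def)
    ultimately show ?thesis using TT' iter by simp
  qed
  define w where "w n = fst (st n)" for n
  have "w (n + 1) = snd (st n)" for n
    by (simp add: w_def st_step T_def split_beta)
  moreover have "snd (st (n + 1)) = P_ring \<otimes> snd (st n) \<ominus> Q_ring \<otimes> fst (st n)" for n
    by (simp add: st_step T_def split_beta)
  ultimately have "w (n + 1 + 1) = P_ring \<otimes> w (n + 1) \<ominus> Q_ring \<otimes> w n" for n
    by (simp only: w_def)
  moreover have "n + 1 + 1 = n + 2" for n :: int by simp
  ultimately have "w (n + 2) = P_ring \<otimes> w (n + 1) \<ominus> Q_ring \<otimes> w n" for n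
    by metis
  moreover have "w n \<in> carrier R" for n
    using st_closed[of n] by (auto simp: w_def C_def)
  ultimately have "w \<in> rec_seqs R P Q" by (simp add: rec_seqs_iff)
  moreover have "w 0 = b" "w 1 = a"
    by (simp_all add: w_def st_def T_def)
  ultimately show ?thesis by blast
qed

lemma seq_of:
  assumes "a \<in> carrier R" "b \<in> carrier R"
  shows seq_of_in: "seq_of R P Q a b \<in> rec_seqs R P Q"
    and seq_of_1: "seq_of R P Q a b 1 = a"
    and seq_of_0: "seq_of R P Q a b 0 = b"
proof -
  have "\<exists>!w. w \<in> rec_seqs R P Q \<and> w 1 = a \<and> w 0 = b"
  proof (rule ex_ex1I)
    show "\<exists>w. w \<in> rec_seqs R P Q \<and> w 1 = a \<and> w 0 = b"
      using rec_seqs_exist[OF assms] by blast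
    show "w = v" if "w \<in> rec_seqs R P Q \<and> w 1 = a \<and> w 0 = b"
        "v \<in> rec_seqs R P Q \<and> v 1 = a \<and> v 0 = b" for w v
      using that by (intro rec_seqs_unique) auto
  qed
  from theI'[OF this] show "seq_of R P Q a b \<in> rec_seqs R P Q" "seq_of R P Q a b 1 = a"
      "seq_of R P Q a b 0 = b"
    unfolding seq_of_def by blast+
qed

lemma rec_seqs_scale:
  assumes v: "v \<in> rec_seqs R P Q" and c[simp]: "c \<in> carrier R"
  shows "(\<lambda>n. c \<otimes> v n) \<in> rec_seqs R P Q"
proof -
  have "c \<otimes> (p \<otimes> x \<ominus> q \<otimes> y) = p \<otimes> (c \<otimes> x) \<ominus> q \<otimes> (c \<otimes> y)"
    if [simp]: "p \<in> carrier R" "q \<in> carrier R" "x \<in> carrier R" "y \<in> carrier R" for p q x y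
    using that c by algebra
  thus ?thesis using v by (simp add: rec_seqs_iff)
qed

section \<open>The group of classes and a criterion for isomorphisms\<close>

lemma seq_group_carrier_iff:
  "w \<in> carrier (seq_group R P Q) \<longleftrightarrow> w \<in> rec_seqs R P Q \<and> Lam R P Q (w 1) (w 0) \<in> Units R"
  by (simp add: seq_group_def)

lemma seq_group_carrier_closed:
  "w \<in> carrier (seq_group R P Q) \<Longrightarrow> w n \<in> carrier R"
  by (auto simp: seq_group_def rec_seqs_def)

lemma seq_group_carrier_Lam:
  "w \<in> carrier (seq_group R P Q) \<Longrightarrow> Lam R P Q (w 1) (w 0) \<in> Units R"
  by (simp add: seq_group_def)

text \<open>A scalar multiple of a solution is again a solution, and solutions are determined by
  their terms at \<open>1\<close> and \<open>0\<close>. Hence proportionality can be tested on these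
  two terms.\<close>

lemma seq_equiv_iff:
  "(w, v) \<in> seq_equiv R P Q \<longleftrightarrow>
     w \<in> carrier (seq_group R P Q) \<and> v \<in> carrier (seq_group R P Q) \<and>
     (\<exists>c \<in> Units R. w 1 = c \<otimes> v 1 \<and> w 0 = c \<otimes> v 0)"
proof -
  have "w = (\<lambda>n. c \<otimes> v n)" if "w \<in> rec_seqs R P Q" "v \<in> rec_seqs R P Q" "c \<in> Units R"
    "w 1 = c \<otimes> v 1" "w 0 = c \<otimes> v 0" for c
    using that by (intro rec_seqs_unique rec_seqs_scale) auto
  thus ?thesis
    unfolding seq_equiv_def seq_group_carrier_iff by (auto dest: fun_cong)
qed

lemma equiv_seq_equiv: "equiv (carrier (seq_group R P Q)) (seq_equiv R P Q)"
proof (rule equivI)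
  show "seq_equiv R P Q \<subseteq> carrier (seq_group R P Q) \<times> carrier (seq_group R P Q)"
    by (auto simp: seq_equiv_def)
  show "refl_on (carrier (seq_group R P Q)) (seq_equiv R P Q)"
    by (rule refl_onI) (auto simp: seq_equiv_iff seq_group_carrier_closed intro!: bexI[of _ \<one>])
  show "sym (seq_equiv R P Q)"
  proof (rule symI)
    fix w v assume "(w, v) \<in> seq_equiv R P Q"
    then obtain c where c: "w \<in> carrier (seq_group R P Q)" "v \<in> carrier (seq_group R P Q)"
      "c \<in> Units R" "w 1 = c \<otimes> v 1" "w 0 = c \<otimes> v 0"
      by (auto simp: seq_equiv_iff)
    have "inv c \<in> Units R" "v 1 = inv c \<otimes> w 1" "v 0 = inv c \<otimes> w 0"
      using c by (auto simp: m_assoc[symmetric] seq_group_carrier_closed Units_closed)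
    thus "(v, w) \<in> seq_equiv R P Q" using c by (auto simp: seq_equiv_iff)
  qed
  show "trans (seq_equiv R P Q)"
  proof (rule transI)
    fix w v u assume "(w, v) \<in> seq_equiv R P Q" "(v, u) \<in> seq_equiv R P Q"
    then obtain c d where c: "w \<in> carrier (seq_group R P Q)" "v \<in> carrier (seq_group R P Q)"
      "c \<in> Units R" "w 1 = c \<otimes> v 1" "w 0 = c \<otimes> v 0"
      and d: "u \<in> carrier (seq_group R P Q)" "d \<in> Units R" "v 1 = d \<otimes> u 1" "v 0 = d \<otimes> u 0"
      unfolding seq_equiv_iff by blast
    hence "c \<otimes> d \<in> Units R" "w 1 = (c \<otimes> d) \<otimes> u 1" "w 0 = (c \<otimes> d) \<otimes> u 0"
      by (auto simp: m_assoc seq_group_carrier_closed Units_closed)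
    thus "(w, u) \<in> seq_equiv R P Q" using c d unfolding seq_equiv_iff by blast
  qed
qed

lemma seq_group_mult:
  assumes "w \<in> carrier (seq_group R P Q)" "v \<in> carrier (seq_group R P Q)"
  shows seq_group_mult_in: "w \<otimes>\<^bsub>seq_group R P Q\<^esub> v \<in> carrier (seq_group R P Q)"
    and seq_group_mult_1: "(w \<otimes>\<^bsub>seq_group R P Q\<^esub> v) 1 = prod1 (w 1) (w 0) (v 1) (v 0)"
    and seq_group_mult_0: "(w \<otimes>\<^bsub>seq_group R P Q\<^esub> v) 0 = prod0 (w 1) (w 0) (v 1) (v 0)"
proof -
  have [simp]: "w n \<in> carrier R" "v n \<in> carrier R" for n
    using assms seq_group_carrier_closed by auto
  have m: "w \<otimes>\<^bsub>seq_group R P Q\<^esub> v =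
      seq_of R P Q (prod1 (w 1) (w 0) (v 1) (v 0)) (prod0 (w 1) (w 0) (v 1) (v 0))"
    by (simp add: seq_group_def)
  show 1: "(w \<otimes>\<^bsub>seq_group R P Q\<^esub> v) 1 = prod1 (w 1) (w 0) (v 1) (v 0)"
    and 0: "(w \<otimes>\<^bsub>seq_group R P Q\<^esub> v) 0 = prod0 (w 1) (w 0) (v 1) (v 0)"
    unfolding m by (simp_all add: seq_of_1 seq_of_0)
  show "w \<otimes>\<^bsub>seq_group R P Q\<^esub> v \<in> carrier (seq_group R P Q)"
    unfolding seq_group_carrier_iff 1 0
    using assms by (auto simp: m seq_of_in Lam_prod seq_group_carrier_iff)
qed

text \<open>The product of classes is a union over all pairs of representatives. By
  \<open>prod_scale\<close> every member of this union is the same class, so the union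
  collapses.\<close>

lemma class_group_mult:
  assumes w: "w \<in> carrier (seq_group R P Q)" and v: "v \<in> carrier (seq_group R P Q)"
  shows "(seq_equiv R P Q `` {w}) \<otimes>\<^bsub>class_group R P Q\<^esub> (seq_equiv R P Q `` {v})
           = seq_equiv R P Q `` {w \<otimes>\<^bsub>seq_group R P Q\<^esub> v}"
proof -
  have "seq_equiv R P Q `` {w' \<otimes>\<^bsub>seq_group R P Q\<^esub> v'} = seq_equiv R P Q `` {w \<otimes>\<^bsub>seq_group R P Q\<^esub> v}"
    if w': "(w, w') \<in> seq_equiv R P Q" and v': "(v, v') \<in> seq_equiv R P Q" for w' v'
  proof -
    from w' v' obtain c d where c: "c \<in> Units R" "w 1 = c \<otimes> w' 1" "w 0 = c \<otimes> w' 0"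
      and d: "d \<in> Units R" "v 1 = d \<otimes> v' 1" "v 0 = d \<otimes> v' 0"
      and in': "w' \<in> carrier (seq_group R P Q)" "v' \<in> carrier (seq_group R P Q)"
      unfolding seq_equiv_iff by blast
    have [simp]: "w' n \<in> carrier R" "v' n \<in> carrier R" for n
      using in' seq_group_carrier_closed by auto
    have "(w \<otimes>\<^bsub>seq_group R P Q\<^esub> v, w' \<otimes>\<^bsub>seq_group R P Q\<^esub> v') \<in> seq_equiv R P Q"
      unfolding seq_equiv_iff
    proof (intro conjI bexI[of _ "c \<otimes> d"])
      show "(w \<otimes>\<^bsub>seq_group R P Q\<^esub> v) 1 = c \<otimes> d \<otimes> (w' \<otimes>\<^bsub>seq_group R P Q\<^esub> v') 1"
        "(w \<otimes>\<^bsub>seq_group R P Q\<^esub> v) 0 = c \<otimes> d \<otimes> (w' \<otimes>\<^bsub>seq_group R P Q\<^esub> v') 0"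
        unfolding seq_group_mult_1[OF w v] seq_group_mult_1[OF in']
          seq_group_mult_0[OF w v] seq_group_mult_0[OF in'] c(2,3) d(2,3)
        by (intro prod_scale; simp add: c(1) d(1) Units_closed)+
    qed (use c d w v in' seq_group_mult_in in auto)
    thus ?thesis using equiv_class_eq[OF equiv_seq_equiv] by blast
  qed
  moreover have "(w, w) \<in> seq_equiv R P Q" "(v, v) \<in> seq_equiv R P Q"
    using equiv_seq_equiv w v by (auto simp: equiv_def refl_on_def)
  ultimately show ?thesis
    unfolding class_group_def monoid.simps by blast
qed

text \<open>Everything is reduced to pairs of unit norm: \<open>g\<close> has image
  \<open>H\<close>, respects products, and its fibres are exactly the proportionality classes. As
  \<open>iso\<close> asks for a bijection respecting products, nothing further about
  \<open>H\<close> has to be supplied.\<close>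

lemma class_iso_viaI:
  assumes surj: "\<And>y. y \<in> carrier H \<longleftrightarrow>
        (\<exists>a \<in> carrier R. \<exists>b \<in> carrier R. Lam R P Q a b \<in> Units R \<and> y = g a b)"
    and hom: "\<And>a b c d. a \<in> carrier R \<Longrightarrow> b \<in> carrier R \<Longrightarrow> c \<in> carrier R \<Longrightarrow> d \<in> carrier R \<Longrightarrow>
        Lam R P Q a b \<in> Units R \<Longrightarrow> Lam R P Q c d \<in> Units R \<Longrightarrow>
        g (prod1 a b c d) (prod0 a b c d) = g a b \<otimes>\<^bsub>H\<^esub> g c d"
    and fibre: "\<And>a b c d. a \<in> carrier R \<Longrightarrow> b \<in> carrier R \<Longrightarrow> c \<in> carrier R \<Longrightarrow> d \<in> carrier R \<Longrightarrow>
        Lam R P Q a b \<in> Units R \<Longrightarrow> Lam R P Q c d \<in> Units R \<Longrightarrow>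
        g a b = g c d \<longleftrightarrow> (\<exists>k \<in> Units R. a = k \<otimes> c \<and> b = k \<otimes> d)"
  shows "class_iso_via R P Q H g"
proof -
  let ?C = "carrier (seq_group R P Q)" and ?r = "seq_equiv R P Q"
  \<comment> \<open>The value is read off from an arbitrary representative; \<open>fibre\<close>
    makes it independent of the choice.\<close>
  define \<phi> where "\<phi> A = (let w = SOME w. w \<in> A in g (w 1) (w 0))" for A :: "(int \<Rightarrow> 'a) set"
  have fib: "g (w 1) (w 0) = g (v 1) (v 0) \<longleftrightarrow> (w, v) \<in> ?r" if "w \<in> ?C" "v \<in> ?C" for w v
    using that fibre[of "w 1" "w 0" "v 1" "v 0"]
    by (auto simp: seq_equiv_iff seq_group_carrier_closed) (auto simp: seq_group_carrier_iff)
  have \<phi>: "\<phi> (?r `` {w}) = g (w 1) (w 0)" if w: "w \<in> ?C" for w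
  proof -
    have "w \<in> ?r `` {w}" using equiv_class_self[OF equiv_seq_equiv w] .
    hence "(SOME v. v \<in> ?r `` {w}) \<in> ?r `` {w}" by (rule someI[of "\<lambda>v. v \<in> ?r `` {w}"])
    moreover from this have "(SOME v. v \<in> ?r `` {w}) \<in> ?C"
      by (auto simp: seq_equiv_iff)
    ultimately show ?thesis using fib[OF w] unfolding \<phi>_def Let_def by (metis Image_singleton_iff)
  qed
  have seq_in: "seq_of R P Q a b \<in> ?C"
    if "a \<in> carrier R" "b \<in> carrier R" "Lam R P Q a b \<in> Units R" for a b
    using that by (simp add: seq_group_carrier_iff seq_of_in seq_of_1 seq_of_0)
  have \<phi>_class: "\<phi> (seq_class R P Q a b) = g a b"
    if "a \<in> carrier R" "b \<in> carrier R" "Lam R P Q a b \<in> Units R" for a b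
    using that by (simp add: seq_class_def \<phi> seq_in seq_of_1 seq_of_0)
  have carr: "carrier (class_group R P Q) = ?C // ?r" by (simp add: class_group_def)
  have "\<phi> \<in> iso (class_group R P Q) H"
  proof (rule isoI)
    show "\<phi> \<in> hom (class_group R P Q) H"
    proof (rule homI)
      fix A assume "A \<in> carrier (class_group R P Q)"
      then obtain w where w: "w \<in> ?C" "A = ?r `` {w}" unfolding carr by (auto elim: quotientE)
      thus "\<phi> A \<in> carrier H"
        using surj[of "\<phi> A"] seq_group_carrier_closed[of w] seq_group_carrier_Lam[of w] by (auto simp: \<phi>)
    next
      fix A B assume "A \<in> carrier (class_group R P Q)" "B \<in> carrier (class_group R P Q)"
      then obtain w v where w: "w \<in> ?C" "A = ?r `` {w}" and v: "v \<in> ?C" "B = ?r `` {v}"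
        unfolding carr by (auto elim!: quotientE)
      show "\<phi> (A \<otimes>\<^bsub>class_group R P Q\<^esub> B) = \<phi> A \<otimes>\<^bsub>H\<^esub> \<phi> B"
        unfolding w(2) v(2) class_group_mult[OF w(1) v(1)] \<phi>[OF w(1)] \<phi>[OF v(1)]
          \<phi>[OF seq_group_mult_in[OF w(1) v(1)]] seq_group_mult_1[OF w(1) v(1)] seq_group_mult_0[OF w(1) v(1)]
        using w(1) v(1) by (intro hom) (auto intro: seq_group_carrier_closed seq_group_carrier_Lam)
    qed
    show "bij_betw \<phi> (carrier (class_group R P Q)) (carrier H)"
      unfolding bij_betw_def
    proof
      show "inj_on \<phi> (carrier (class_group R P Q))"
      proof (rule inj_onI)
        fix A B assume "A \<in> carrier (class_group R P Q)" "B \<in> carrier (class_group R P Q)"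
          and eq: "\<phi> A = \<phi> B"
        then obtain w v where w: "w \<in> ?C" "A = ?r `` {w}" and v: "v \<in> ?C" "B = ?r `` {v}"
          unfolding carr by (auto elim!: quotientE)
        with eq have "(w, v) \<in> ?r" using fib by (simp add: \<phi>)
        thus "A = B" using w v equiv_class_eq[OF equiv_seq_equiv] by simp
      qed
      show "\<phi> ` carrier (class_group R P Q) = carrier H"
      proof
        show "\<phi> ` carrier (class_group R P Q) \<subseteq> carrier H"
        proof
          fix y assume "y \<in> \<phi> ` carrier (class_group R P Q)"
          then obtain w where "w \<in> ?C" "y = g (w 1) (w 0)"
            unfolding carr by (auto elim!: quotientE simp: \<phi>)
          thus "y \<in> carrier H"
            using surj[of y] seq_group_carrier_closed[of w] seq_group_carrier_Lam[of w] by auto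
        qed
        show "carrier H \<subseteq> \<phi> ` carrier (class_group R P Q)"
        proof
          fix y assume "y \<in> carrier H"
          then obtain a b where ab: "a \<in> carrier R" "b \<in> carrier R" "Lam R P Q a b \<in> Units R" "y = g a b"
            using surj by blast
          hence "y = \<phi> (seq_class R P Q a b)" by (simp add: \<phi>_class)
          moreover have "seq_class R P Q a b \<in> carrier (class_group R P Q)"
            unfolding carr seq_class_def using seq_in ab by (auto intro: quotientI)
          ultimately show "y \<in> \<phi> ` carrier (class_group R P Q)" by blast
        qed
      qed
    qed
  qed
  thus ?thesis unfolding class_iso_via_def using \<phi>_class by blast
qed

end

section \<open>Split and double roots\<close>

text \<open>Evaluation at a root \<open>t\<close> of \<open>f\<close> is multiplicative on
  \<open>R[t]/(f)\<close>: the two sides differ by \<open>b d\<close> times the value of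
  \<open>f\<close> at \<open>t\<close>, up to sign.\<close>

lemma (in cring) root_eval_prod:
  assumes [simp]: "a \<in> carrier R" "b \<in> carrier R" "c \<in> carrier R" "d \<in> carrier R"
    "p \<in> carrier R" "q \<in> carrier R" "t \<in> carrier R"
    and root: "t \<otimes> t = p \<otimes> t \<ominus> q"
  shows "(a \<otimes> c \<ominus> q \<otimes> b \<otimes> d) \<ominus> (b \<otimes> c \<oplus> a \<otimes> d \<ominus> p \<otimes> b \<otimes> d) \<otimes> t
          = (a \<ominus> b \<otimes> t) \<otimes> (c \<ominus> d \<otimes> t)" (is "?l = ?r")
proof -
  have "?l = ?r \<oplus> b \<otimes> d \<otimes> ((p \<otimes> t \<ominus> q) \<ominus> t \<otimes> t)"
    using assms(1-7) by algebra
  also have "(p \<otimes> t \<ominus> q) \<ominus> t \<otimes> t = \<zero>" by (simp add: root)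
  finally show ?thesis by simp
qed

lemma (in cring) split_root:
  assumes [simp]: "\<alpha> \<in> carrier R" "\<beta> \<in> carrier R" and "\<alpha> \<oplus> \<beta> = p" "\<alpha> \<otimes> \<beta> = q"
  shows "\<alpha> \<otimes> \<alpha> = p \<otimes> \<alpha> \<ominus> q" "\<beta> \<otimes> \<beta> = p \<otimes> \<beta> \<ominus> q"
  unfolding assms(3,4)[symmetric] using assms(1,2) by algebra+

text \<open>Congruence to \<open>1\<close> modulo a unit is no condition. This identifies the target
  group with all units when the roots differ by a unit.\<close>

lemma (in cring) one_plus_unit_mult:
  assumes d: "d \<in> Units R" and u[simp]: "u \<in> carrier R"
  shows "\<exists>x \<in> carrier R. u = \<one> \<oplus> d \<otimes> x"
proof (rule bexI)
  have "d \<otimes> (inv d \<otimes> (u \<ominus> \<one>)) = u \<ominus> \<one>"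
    using d by (simp add: m_assoc[symmetric] Units_closed)
  moreover have "u = \<one> \<oplus> (u \<ominus> \<one>)" using u by algebra
  ultimately show "u = \<one> \<oplus> d \<otimes> (inv d \<otimes> (u \<ominus> \<one>))" by simp
  show "inv d \<otimes> (u \<ominus> \<one>) \<in> carrier R" using d by simp
qed

lemma (in comm_monoid) unit_frac_eq_iff:
  assumes [simp]: "x \<in> carrier G" "z \<in> carrier G" and u: "y \<in> Units G" "w \<in> Units G"
  shows "x \<otimes> inv y = z \<otimes> inv w \<longleftrightarrow> x \<otimes> w = z \<otimes> y"
proof -
  have [simp]: "y \<in> carrier G" "w \<in> carrier G" "inv y \<in> carrier G" "inv w \<in> carrier G"
    using u by auto
  have "x \<otimes> inv y = z \<otimes> inv w \<longleftrightarrow> (y \<otimes> w) \<otimes> (x \<otimes> inv y) = (y \<otimes> w) \<otimes> (z \<otimes> inv w)"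
    using u by (intro Units_l_cancel[symmetric]) auto
  also have "(y \<otimes> w) \<otimes> (x \<otimes> inv y) = (x \<otimes> w) \<otimes> (y \<otimes> inv y)" by (simp add: m_ac)
  also have "(y \<otimes> w) \<otimes> (z \<otimes> inv w) = (z \<otimes> y) \<otimes> (w \<otimes> inv w)" by (simp add: m_ac)
  finally show ?thesis using u by simp
qed

lemma (in comm_monoid) inv_mult_Units:
  assumes "x \<in> Units G" "y \<in> Units G"
  shows "inv (x \<otimes> y) = inv x \<otimes> inv y"
proof (rule comm_inv_char)
  have [simp]: "x \<in> carrier G" "y \<in> carrier G" "inv x \<in> carrier G" "inv y \<in> carrier G"
    using assms by auto
  have "x \<otimes> y \<otimes> (inv x \<otimes> inv y) = (x \<otimes> inv x) \<otimes> (y \<otimes> inv y)" by (simp add: m_ac)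
  thus "x \<otimes> y \<otimes> (inv x \<otimes> inv y) = \<one>" using assms by simp
qed (use assms in auto)

context quad_ring
begin

lemma Lam_split:
  assumes [simp]: "\<alpha> \<in> carrier R" "\<beta> \<in> carrier R" and "\<alpha> \<oplus> \<beta> = P_ring" "\<alpha> \<otimes> \<beta> = Q_ring"
    and [simp]: "a \<in> carrier R" "b \<in> carrier R"
  shows "Lam R P Q a b = (a \<ominus> b \<otimes> \<alpha>) \<otimes> (a \<ominus> b \<otimes> \<beta>)"
  unfolding Lam_def assms(3,4)[symmetric] using assms(1,2,5,6) by algebra

lemma Lam_split_Units_iff:
  assumes "\<alpha> \<in> carrier R" "\<beta> \<in> carrier R" "\<alpha> \<oplus> \<beta> = P_ring" "\<alpha> \<otimes> \<beta> = Q_ring"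
    and "a \<in> carrier R" "b \<in> carrier R"
  shows "Lam R P Q a b \<in> Units R \<longleftrightarrow> a \<ominus> b \<otimes> \<alpha> \<in> Units R \<and> a \<ominus> b \<otimes> \<beta> \<in> Units R"
  unfolding Lam_split[OF assms]
  using assms prod_unit_l unit_factor m_comm by (metis Units_m_closed m_closed minus_closed)

text \<open>\<open>cancel\<close> says that \<open>\<beta> \<ominus> \<alpha>\<close> is not a zero
  divisor, which gives injectivity. The carrier of \<open>H\<close> consists of the units congruent
  to \<open>1\<close> modulo \<open>\<beta> \<ominus> \<alpha>\<close>; keeping \<open>H\<close>
  abstract lets it be the full unit group or \<open>1 + p^k Z_(p)\<close>.\<close>

lemma class_iso_via_split:
  assumes \<alpha>[simp]: "\<alpha> \<in> carrier R" and \<beta>[simp]: "\<beta> \<in> carrier R"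
    and sum: "\<alpha> \<oplus> \<beta> = P_ring" and prd: "\<alpha> \<otimes> \<beta> = Q_ring"
    and cancel: "\<And>x. x \<in> carrier R \<Longrightarrow> (\<beta> \<ominus> \<alpha>) \<otimes> x = \<zero> \<Longrightarrow> x = \<zero>"
    and carrier_H: "carrier H = {u \<in> Units R. \<exists>x \<in> carrier R. u = \<one> \<oplus> (\<beta> \<ominus> \<alpha>) \<otimes> x}"
    and mult_H: "\<And>x y. x \<otimes>\<^bsub>H\<^esub> y = x \<otimes> y"
  shows "class_iso_via R P Q H (\<lambda>a b. (a \<ominus> b \<otimes> \<alpha>) \<otimes> inv (a \<ominus> b \<otimes> \<beta>))"
proof (rule class_iso_viaI)
  note unit_iff = Lam_split_Units_iff[OF \<alpha> \<beta> sum prd]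
  fix y
  show "y \<in> carrier H \<longleftrightarrow> (\<exists>a \<in> carrier R. \<exists>b \<in> carrier R. Lam R P Q a b \<in> Units R \<and>
          y = (a \<ominus> b \<otimes> \<alpha>) \<otimes> inv (a \<ominus> b \<otimes> \<beta>))"
  proof
    assume "y \<in> carrier H"
    then obtain x where y: "y \<in> Units R" "y = \<one> \<oplus> (\<beta> \<ominus> \<alpha>) \<otimes> x" and x[simp]: "x \<in> carrier R"
      by (auto simp: carrier_H)
    \<comment> \<open>The witness is the pair \<open>(1 + x \<beta>, x)\<close>: its value at
      \<open>\<beta>\<close> is normalized to \<open>1\<close>, so its value at
      \<open>\<alpha>\<close> is the quotient itself.\<close>
    have 1: "(\<one> \<oplus> x \<otimes> \<beta>) \<ominus> x \<otimes> \<alpha> = y"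
      unfolding y(2) using x \<alpha> \<beta> by algebra
    have 2: "(\<one> \<oplus> x \<otimes> \<beta>) \<ominus> x \<otimes> \<beta> = \<one>"
      using x \<alpha> \<beta> by algebra
    show "\<exists>a \<in> carrier R. \<exists>b \<in> carrier R. Lam R P Q a b \<in> Units R \<and>
          y = (a \<ominus> b \<otimes> \<alpha>) \<otimes> inv (a \<ominus> b \<otimes> \<beta>)"
      using y(1) by (intro bexI[of _ "\<one> \<oplus> x \<otimes> \<beta>"] bexI[of _ x]) (auto simp: unit_iff 1 2 Units_closed)
  next
    assume "\<exists>a \<in> carrier R. \<exists>b \<in> carrier R. Lam R P Q a b \<in> Units R \<and>
          y = (a \<ominus> b \<otimes> \<alpha>) \<otimes> inv (a \<ominus> b \<otimes> \<beta>)"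
    then obtain a b where ab[simp]: "a \<in> carrier R" "b \<in> carrier R"
      and u: "a \<ominus> b \<otimes> \<alpha> \<in> Units R" "a \<ominus> b \<otimes> \<beta> \<in> Units R"
      and y: "y = (a \<ominus> b \<otimes> \<alpha>) \<otimes> inv (a \<ominus> b \<otimes> \<beta>)"
      by (auto simp: unit_iff)
    define i where "i = inv (a \<ominus> b \<otimes> \<beta>)"
    have i[simp]: "i \<in> carrier R" and i1: "(a \<ominus> b \<otimes> \<beta>) \<otimes> i = \<one>"
      using u by (auto simp: i_def)
    \<comment> \<open>From
      \<open>a - b \<alpha> = (a - b \<beta>) + (\<beta> - \<alpha>) b\<close>.\<close>
    have "y = (a \<ominus> b \<otimes> \<beta>) \<otimes> i \<oplus> (\<beta> \<ominus> \<alpha>) \<otimes> (b \<otimes> i)"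
      unfolding y i_def[symmetric] using ab i \<alpha> \<beta> by algebra
    hence "y = \<one> \<oplus> (\<beta> \<ominus> \<alpha>) \<otimes> (b \<otimes> i)" by (simp add: i1)
    moreover have "y \<in> Units R" using u by (simp add: y)
    ultimately show "y \<in> carrier H" by (auto simp: carrier_H)
  qed
next
  fix a b c d
  assume abcd[simp]: "a \<in> carrier R" "b \<in> carrier R" "c \<in> carrier R" "d \<in> carrier R"
    and "Lam R P Q a b \<in> Units R" "Lam R P Q c d \<in> Units R"
  hence u: "a \<ominus> b \<otimes> \<alpha> \<in> Units R" "a \<ominus> b \<otimes> \<beta> \<in> Units R"
     "c \<ominus> d \<otimes> \<alpha> \<in> Units R" "c \<ominus> d \<otimes> \<beta> \<in> Units R"
    by (auto simp: Lam_split_Units_iff[OF \<alpha> \<beta> sum prd])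
  note roots = split_root[OF \<alpha> \<beta> sum prd]
  have "prod1 a b c d \<ominus> prod0 a b c d \<otimes> \<alpha> = (a \<ominus> b \<otimes> \<alpha>) \<otimes> (c \<ominus> d \<otimes> \<alpha>)"
    "prod1 a b c d \<ominus> prod0 a b c d \<otimes> \<beta> = (a \<ominus> b \<otimes> \<beta>) \<otimes> (c \<ominus> d \<otimes> \<beta>)"
    by (intro root_eval_prod roots; simp)+
  thus "(prod1 a b c d \<ominus> prod0 a b c d \<otimes> \<alpha>) \<otimes> inv (prod1 a b c d \<ominus> prod0 a b c d \<otimes> \<beta>)
      = (a \<ominus> b \<otimes> \<alpha>) \<otimes> inv (a \<ominus> b \<otimes> \<beta>) \<otimes>\<^bsub>H\<^esub> ((c \<ominus> d \<otimes> \<alpha>) \<otimes> inv (c \<ominus> d \<otimes> \<beta>))"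
    using u by (simp add: mult_H inv_mult_Units m_ac)
  show "(a \<ominus> b \<otimes> \<alpha>) \<otimes> inv (a \<ominus> b \<otimes> \<beta>) = (c \<ominus> d \<otimes> \<alpha>) \<otimes> inv (c \<ominus> d \<otimes> \<beta>)
     \<longleftrightarrow> (\<exists>k \<in> Units R. a = k \<otimes> c \<and> b = k \<otimes> d)"
    unfolding unit_frac_eq_iff[OF _ _ u(2,4), of "a \<ominus> b \<otimes> \<alpha>" "c \<ominus> d \<otimes> \<alpha>", simplified]
  proof
    assume "\<exists>k \<in> Units R. a = k \<otimes> c \<and> b = k \<otimes> d"
    then obtain k where k: "k \<in> Units R" "a = k \<otimes> c" "b = k \<otimes> d" by blast
    have kc[simp]: "k \<in> carrier R" using k by auto
    show "(a \<ominus> b \<otimes> \<alpha>) \<otimes> (c \<ominus> d \<otimes> \<beta>) = (c \<ominus> d \<otimes> \<alpha>) \<otimes> (a \<ominus> b \<otimes> \<beta>)"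
      unfolding k(2,3) using abcd kc \<alpha> \<beta> by algebra
  next
    assume eq: "(a \<ominus> b \<otimes> \<alpha>) \<otimes> (c \<ominus> d \<otimes> \<beta>) = (c \<ominus> d \<otimes> \<alpha>) \<otimes> (a \<ominus> b \<otimes> \<beta>)"
    define j where "j = inv (c \<ominus> d \<otimes> \<beta>)"
    have j[simp]: "j \<in> carrier R" and j1: "(c \<ominus> d \<otimes> \<beta>) \<otimes> j = \<one>"
      using u by (auto simp: j_def)
    \<comment> \<open>The factor must be the ratio of the values at \<open>\<beta>\<close>. Equality
      of the quotients makes it the ratio of the values at \<open>\<alpha>\<close> as well.\<close>
    define k where "k = (a \<ominus> b \<otimes> \<beta>) \<otimes> j"
    have ku: "k \<in> Units R" using u by (simp add: k_def j_def)
    hence k[simp]: "k \<in> carrier R" by auto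
    have "k \<otimes> (c \<ominus> d \<otimes> \<beta>) = (a \<ominus> b \<otimes> \<beta>) \<otimes> ((c \<ominus> d \<otimes> \<beta>) \<otimes> j)"
      unfolding k_def using abcd j \<alpha> \<beta> by algebra
    hence kb: "k \<otimes> (c \<ominus> d \<otimes> \<beta>) = a \<ominus> b \<otimes> \<beta>" by (simp add: j1)
    have "k \<otimes> (c \<ominus> d \<otimes> \<alpha>) = (c \<ominus> d \<otimes> \<alpha>) \<otimes> (a \<ominus> b \<otimes> \<beta>) \<otimes> j"
      unfolding k_def using abcd j \<alpha> \<beta> by algebra
    also have "\<dots> = (a \<ominus> b \<otimes> \<alpha>) \<otimes> ((c \<ominus> d \<otimes> \<beta>) \<otimes> j)"
      unfolding eq[symmetric] by (rule m_assoc) simp_all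
    finally have ka: "k \<otimes> (c \<ominus> d \<otimes> \<alpha>) = a \<ominus> b \<otimes> \<alpha>" by (simp add: j1)
    \<comment> \<open>Subtracting the two evaluations eliminates \<open>a - k c\<close> and isolates
      \<open>b - k d\<close>.\<close>
    have "(\<beta> \<ominus> \<alpha>) \<otimes> (b \<ominus> k \<otimes> d) = (a \<ominus> b \<otimes> \<alpha> \<ominus> k \<otimes> (c \<ominus> d \<otimes> \<alpha>)) \<ominus> (a \<ominus> b \<otimes> \<beta> \<ominus> k \<otimes> (c \<ominus> d \<otimes> \<beta>))"
      using abcd k \<alpha> \<beta> by algebra
    also have "\<dots> = \<zero> \<ominus> \<zero>"
      unfolding ka kb by (intro arg_cong2[where f = "\<lambda>x y. x \<ominus> y"]) simp_all
    finally have "(\<beta> \<ominus> \<alpha>) \<otimes> (b \<ominus> k \<otimes> d) = \<zero>" by simp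
    hence bz: "b \<ominus> k \<otimes> d = \<zero>" using cancel[of "b \<ominus> k \<otimes> d"] by simp
    hence b: "b = k \<otimes> d" by (rule eq_by_diff) simp_all
    have "a \<ominus> k \<otimes> c = (a \<ominus> b \<otimes> \<alpha> \<ominus> k \<otimes> (c \<ominus> d \<otimes> \<alpha>)) \<oplus> (b \<ominus> k \<otimes> d) \<otimes> \<alpha>"
      using abcd k \<alpha> \<beta> by algebra
    also have "\<dots> = \<zero> \<oplus> \<zero>"
      unfolding ka bz by (intro arg_cong2[where f = "(\<oplus>)"]) simp_all
    finally have "a \<ominus> k \<otimes> c = \<zero>" by simp
    hence "a = k \<otimes> c" by (rule eq_by_diff) simp_all
    thus "\<exists>k \<in> Units R. a = k \<otimes> c \<and> b = k \<otimes> d" using ku b by blast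
  qed
qed

text \<open>Here \<open>R[t]/(f)\<close> is the ring of dual numbers, with
  \<open>\<epsilon> = t - \<alpha>\<close> and \<open>\<epsilon>^2 = 0\<close>. Dividing
  \<open>a - b t = (a - b \<alpha>) - b \<epsilon>\<close> by the unit \<open>a - b \<alpha>\<close>
  gives \<open>1 + y \<epsilon>\<close>, and products of such elements add the coefficients
  \<open>y\<close>.\<close>

lemma class_iso_via_double:
  assumes \<alpha>[simp]: "\<alpha> \<in> carrier R" and sum: "\<alpha> \<oplus> \<alpha> = P_ring" and prd: "\<alpha> \<otimes> \<alpha> = Q_ring"
  shows "class_iso_via R P Q (add_monoid R) (\<lambda>a b. \<ominus> b \<otimes> inv (a \<ominus> b \<otimes> \<alpha>))"
proof (rule class_iso_viaI)
  note unit_iff = Lam_split_Units_iff[OF \<alpha> \<alpha> sum prd]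
  fix y
  show "y \<in> carrier (add_monoid R) \<longleftrightarrow> (\<exists>a \<in> carrier R. \<exists>b \<in> carrier R.
          Lam R P Q a b \<in> Units R \<and> y = \<ominus> b \<otimes> inv (a \<ominus> b \<otimes> \<alpha>))"
  proof
    assume "y \<in> carrier (add_monoid R)"
    hence y[simp]: "y \<in> carrier R" by simp
    \<comment> \<open>The pair \<open>(1 - y \<alpha>, - y)\<close> represents
      \<open>1 + y (t - \<alpha>)\<close>, whose value at \<open>\<alpha>\<close> is
      \<open>1\<close>.\<close>
    have 1: "(\<one> \<ominus> y \<otimes> \<alpha>) \<ominus> (\<ominus> y) \<otimes> \<alpha> = \<one>"
      using y \<alpha> by algebra
    show "\<exists>a \<in> carrier R. \<exists>b \<in> carrier R. Lam R P Q a b \<in> Units R \<and> y = \<ominus> b \<otimes> inv (a \<ominus> b \<otimes> \<alpha>)"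
      by (intro bexI[of _ "\<one> \<ominus> y \<otimes> \<alpha>"] bexI[of _ "\<ominus> y"]) (auto simp: unit_iff 1)
  qed (auto simp: unit_iff)
next
  fix a b c d
  assume abcd[simp]: "a \<in> carrier R" "b \<in> carrier R" "c \<in> carrier R" "d \<in> carrier R"
    and "Lam R P Q a b \<in> Units R" "Lam R P Q c d \<in> Units R"
  hence u: "a \<ominus> b \<otimes> \<alpha> \<in> Units R" "c \<ominus> d \<otimes> \<alpha> \<in> Units R"
    by (auto simp: Lam_split_Units_iff[OF \<alpha> \<alpha> sum prd])
  define i where "i = inv (a \<ominus> b \<otimes> \<alpha>)"
  define j where "j = inv (c \<ominus> d \<otimes> \<alpha>)"
  have ij[simp]: "i \<in> carrier R" "j \<in> carrier R"
    and i1: "(a \<ominus> b \<otimes> \<alpha>) \<otimes> i = \<one>" and j1: "(c \<ominus> d \<otimes> \<alpha>) \<otimes> j = \<one>"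
    using u by (auto simp: i_def j_def)
  have "prod1 a b c d \<ominus> prod0 a b c d \<otimes> \<alpha> = (a \<ominus> b \<otimes> \<alpha>) \<otimes> (c \<ominus> d \<otimes> \<alpha>)"
    by (intro root_eval_prod split_root(1)[OF \<alpha> \<alpha> sum prd]; simp)
  hence inv: "inv (prod1 a b c d \<ominus> prod0 a b c d \<otimes> \<alpha>) = i \<otimes> j"
    using u by (simp add: inv_mult_Units i_def j_def)
  \<comment> \<open>Since \<open>P = 2 \<alpha>\<close>, \<open>prod0\<close> equals
    \<open>b (c - d \<alpha>) + d (a - b \<alpha>)\<close>; dividing by both values splits the
    fraction into a sum.\<close>
  have "\<ominus> prod0 a b c d \<otimes> (i \<otimes> j)
      = \<ominus> b \<otimes> i \<otimes> ((c \<ominus> d \<otimes> \<alpha>) \<otimes> j) \<oplus> \<ominus> d \<otimes> j \<otimes> ((a \<ominus> b \<otimes> \<alpha>) \<otimes> i)"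
    unfolding sum[symmetric] using abcd ij \<alpha> by algebra
  thus "\<ominus> prod0 a b c d \<otimes> inv (prod1 a b c d \<ominus> prod0 a b c d \<otimes> \<alpha>)
      = \<ominus> b \<otimes> inv (a \<ominus> b \<otimes> \<alpha>) \<otimes>\<^bsub>add_monoid R\<^esub> (\<ominus> d \<otimes> inv (c \<ominus> d \<otimes> \<alpha>))"
    unfolding inv by (simp add: i1 j1 i_def[symmetric] j_def[symmetric])
  show "\<ominus> b \<otimes> inv (a \<ominus> b \<otimes> \<alpha>) = \<ominus> d \<otimes> inv (c \<ominus> d \<otimes> \<alpha>)
      \<longleftrightarrow> (\<exists>k \<in> Units R. a = k \<otimes> c \<and> b = k \<otimes> d)"
    unfolding unit_frac_eq_iff[OF _ _ u, of "\<ominus> b" "\<ominus> d", simplified]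
  proof
    assume "\<exists>k \<in> Units R. a = k \<otimes> c \<and> b = k \<otimes> d"
    then obtain k where k: "k \<in> Units R" "a = k \<otimes> c" "b = k \<otimes> d" by blast
    have kc[simp]: "k \<in> carrier R" using k by auto
    show "\<ominus> b \<otimes> (c \<ominus> d \<otimes> \<alpha>) = \<ominus> d \<otimes> (a \<ominus> b \<otimes> \<alpha>)"
      unfolding k(2,3) using abcd kc \<alpha> by algebra
  next
    assume eq: "\<ominus> b \<otimes> (c \<ominus> d \<otimes> \<alpha>) = \<ominus> d \<otimes> (a \<ominus> b \<otimes> \<alpha>)"
    \<comment> \<open>Again \<open>k\<close> is the ratio of the values at the root; the equality of
      slopes shows that \<open>b\<close> and \<open>d\<close> have this ratio too.\<close>
    define k where "k = (a \<ominus> b \<otimes> \<alpha>) \<otimes> j"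
    have ku: "k \<in> Units R" using u by (simp add: k_def j_def)
    hence k[simp]: "k \<in> carrier R" by auto
    have "k \<otimes> d = \<ominus> (\<ominus> d \<otimes> (a \<ominus> b \<otimes> \<alpha>)) \<otimes> j"
      unfolding k_def using abcd ij \<alpha> by algebra
    also have "\<dots> = b \<otimes> ((c \<ominus> d \<otimes> \<alpha>) \<otimes> j)"
      unfolding eq[symmetric] using abcd ij \<alpha> by algebra
    finally have b: "k \<otimes> d = b" by (simp add: j1)
    have "k \<otimes> c = (a \<ominus> b \<otimes> \<alpha>) \<otimes> ((c \<ominus> d \<otimes> \<alpha>) \<otimes> j) \<oplus> (k \<otimes> d) \<otimes> \<alpha>"
      unfolding k_def using abcd ij \<alpha> by algebra
    also have "\<dots> = a" unfolding j1 b using abcd \<alpha> by algebra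
    finally show "\<exists>k \<in> Units R. a = k \<otimes> c \<and> b = k \<otimes> d" using ku b by blast
  qed
qed

end

section \<open>Quadratic extensions\<close>

text \<open>Independence of \<open>1\<close> and \<open>\<alpha>\<close> over \<open>R\<close> is
  the form of irreducibility used here, because it makes sense for \<open>Z_(p)\<close> as well as
  for fields.\<close>

locale quad_ext = quad_ring R P Q + S: cring L
  for R (structure) and P Q and L (structure) +
  fixes h \<alpha>
  assumes h_hom: "h \<in> ring_hom R L"
    and \<alpha>_closed [simp]: "\<alpha> \<in> carrier L"
    and \<alpha>_root: "\<alpha> \<otimes>\<^bsub>L\<^esub> \<alpha> = h P_ring \<otimes>\<^bsub>L\<^esub> \<alpha> \<ominus>\<^bsub>L\<^esub> h Q_ring"
    and indep: "\<And>a b. a \<in> carrier R \<Longrightarrow> b \<in> carrier R \<Longrightarrow>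
                  h a \<ominus>\<^bsub>L\<^esub> h b \<otimes>\<^bsub>L\<^esub> \<alpha> = \<zero>\<^bsub>L\<^esub> \<Longrightarrow> a = \<zero> \<and> b = \<zero>"
begin

sublocale ring_hom_cring R L h
  by unfold_locales (rule h_hom)

definition lin where "lin a b = h a \<ominus>\<^bsub>L\<^esub> h b \<otimes>\<^bsub>L\<^esub> \<alpha>"

text \<open>Because \<open>\<alpha>\<close> satisfies a monic quadratic equation, the linear
  expressions are already closed under products, so this is the ring generated by
  \<open>\<alpha>\<close> over the image of \<open>R\<close>.\<close>

definition ext :: "'c set" where "ext = {lin a b | a b. a \<in> carrier R \<and> b \<in> carrier R}"

lemma hom_minus: "x \<in> carrier R \<Longrightarrow> y \<in> carrier R \<Longrightarrow> h (x \<ominus> y) = h x \<ominus>\<^bsub>L\<^esub> h y"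
  by (simp add: a_minus_def)

lemma lin_closed [simp]: "a \<in> carrier R \<Longrightarrow> b \<in> carrier R \<Longrightarrow> lin a b \<in> carrier L"
  by (simp add: lin_def)

lemma lin_in_ext: "a \<in> carrier R \<Longrightarrow> b \<in> carrier R \<Longrightarrow> lin a b \<in> ext"
  by (auto simp: ext_def)

lemma lin_zero [simp]: "a \<in> carrier R \<Longrightarrow> lin a \<zero> = h a"
  by (simp add: lin_def a_minus_def)

lemma lin_prod:
  assumes [simp]: "a \<in> carrier R" "b \<in> carrier R" "c \<in> carrier R" "d \<in> carrier R"
  shows "lin (prod1 a b c d) (prod0 a b c d) = lin a b \<otimes>\<^bsub>L\<^esub> lin c d"
  using S.root_eval_prod[of "h a" "h b" "h c" "h d" "h P_ring" "h Q_ring" \<alpha>] \<alpha>_root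
  by (simp add: lin_def hom_minus)

lemma lin_add:
  assumes [simp]: "a \<in> carrier R" "b \<in> carrier R" "c \<in> carrier R" "d \<in> carrier R"
  shows "lin (a \<oplus> c) (b \<oplus> d) = lin a b \<oplus>\<^bsub>L\<^esub> lin c d"
proof -
  have "(x \<oplus>\<^bsub>L\<^esub> z) \<ominus>\<^bsub>L\<^esub> (y \<oplus>\<^bsub>L\<^esub> w) \<otimes>\<^bsub>L\<^esub> t = (x \<ominus>\<^bsub>L\<^esub> y \<otimes>\<^bsub>L\<^esub> t) \<oplus>\<^bsub>L\<^esub> (z \<ominus>\<^bsub>L\<^esub> w \<otimes>\<^bsub>L\<^esub> t)"
    if [simp]: "x \<in> carrier L" "y \<in> carrier L" "z \<in> carrier L" "w \<in> carrier L" "t \<in> carrier L"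
    for x y z w t
    using that by algebra
  thus ?thesis by (simp add: lin_def)
qed

lemma lin_uminus:
  assumes [simp]: "a \<in> carrier R" "b \<in> carrier R"
  shows "lin (\<ominus> a) (\<ominus> b) = \<ominus>\<^bsub>L\<^esub> lin a b"
proof -
  have "(\<ominus>\<^bsub>L\<^esub> x) \<ominus>\<^bsub>L\<^esub> (\<ominus>\<^bsub>L\<^esub> y) \<otimes>\<^bsub>L\<^esub> t = \<ominus>\<^bsub>L\<^esub> (x \<ominus>\<^bsub>L\<^esub> y \<otimes>\<^bsub>L\<^esub> t)"
    if [simp]: "x \<in> carrier L" "y \<in> carrier L" "t \<in> carrier L" for x y t
    using that by algebra
  thus ?thesis by (simp add: lin_def)
qed

lemma lin_inj:
  assumes [simp]: "a \<in> carrier R" "b \<in> carrier R" "c \<in> carrier R" "d \<in> carrier R"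
  shows "lin a b = lin c d \<longleftrightarrow> a = c \<and> b = d"
proof
  assume eq: "lin a b = lin c d"
  have "lin (a \<oplus> \<ominus> c) (b \<oplus> \<ominus> d) = lin a b \<oplus>\<^bsub>L\<^esub> \<ominus>\<^bsub>L\<^esub> lin c d"
    by (subst lin_add) (simp_all only: lin_uminus assms a_inv_closed)
  also have "\<dots> = \<zero>\<^bsub>L\<^esub>" unfolding eq by (rule S.r_neg) simp
  finally have "a \<ominus> c = \<zero> \<and> b \<ominus> d = \<zero>"
    unfolding a_minus_def by (intro indep) (simp_all add: lin_def)
  thus "a = c \<and> b = d" by simp
qed simp

lemma ext_subring: "subring ext L"
proof (rule S.subringI)
  show "ext \<subseteq> carrier L" by (auto simp: ext_def)
  show "\<one>\<^bsub>L\<^esub> \<in> ext" using lin_in_ext[of \<one> \<zero>] by simp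
  show "\<ominus>\<^bsub>L\<^esub> x \<in> ext" if "x \<in> ext" for x
    using that lin_in_ext by (auto simp: ext_def lin_uminus[symmetric])
  show "x \<otimes>\<^bsub>L\<^esub> y \<in> ext" if xy: "x \<in> ext" "y \<in> ext" for x y
  proof -
    obtain a b c d where *: "x = lin a b" "y = lin c d" "a \<in> carrier R" "b \<in> carrier R"
       "c \<in> carrier R" "d \<in> carrier R"
      using xy unfolding ext_def by blast
    show ?thesis unfolding *(1,2) lin_prod[OF *(3-6), symmetric]
      by (rule lin_in_ext) (use * in simp_all)
  qed
  show "x \<oplus>\<^bsub>L\<^esub> y \<in> ext" if xy: "x \<in> ext" "y \<in> ext" for x y
  proof -
    obtain a b c d where *: "x = lin a b" "y = lin c d" "a \<in> carrier R" "b \<in> carrier R"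
       "c \<in> carrier R" "d \<in> carrier R"
      using xy unfolding ext_def by blast
    show ?thesis unfolding *(1,2) lin_add[OF *(3-6), symmetric]
      by (rule lin_in_ext) (use * in simp_all)
  qed
qed

lemma \<alpha>_in_ext: "\<alpha> \<in> ext"
proof -
  have "\<zero>\<^bsub>L\<^esub> \<ominus>\<^bsub>L\<^esub> (\<ominus>\<^bsub>L\<^esub> \<one>\<^bsub>L\<^esub>) \<otimes>\<^bsub>L\<^esub> \<alpha> = \<alpha>"
    if [simp]: "\<alpha> \<in> carrier L" for \<alpha>
    using that by algebra
  thus ?thesis using lin_in_ext[of \<zero> "\<ominus> \<one>"] by (simp add: lin_def)
qed

lemma hom_in_ext: "a \<in> carrier R \<Longrightarrow> h a \<in> ext"
  using lin_in_ext[of a \<zero>] by simp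

text \<open>The second factor is the conjugate of the first.\<close>
lemma lin_conj:
  assumes ab: "a \<in> carrier R" "b \<in> carrier R"
  shows "lin a b \<otimes>\<^bsub>L\<^esub> lin (a \<ominus> b \<otimes> P_ring) (\<ominus> b) = h (Lam R P Q a b)"
proof -
  have "prod1 a b (a \<ominus> b \<otimes> P_ring) (\<ominus> b) = Lam R P Q a b"
    "prod0 a b (a \<ominus> b \<otimes> P_ring) (\<ominus> b) = \<zero>"
  proof -
    define p where "p = P_ring"
    define q where "q = Q_ring"
    have pq: "p \<in> carrier R" "q \<in> carrier R" by (auto simp: p_def q_def)
    note [simp] = ab
    show "prod1 a b (a \<ominus> b \<otimes> P_ring) (\<ominus> b) = Lam R P Q a b"
      unfolding Lam_def p_def[symmetric] q_def[symmetric]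
      using ab pq by algebra
    show "prod0 a b (a \<ominus> b \<otimes> P_ring) (\<ominus> b) = \<zero>"
      unfolding p_def[symmetric] q_def[symmetric] using ab pq by algebra
  qed
  with lin_prod[of a b "a \<ominus> b \<otimes> P_ring" "\<ominus> b"] ab show ?thesis by simp
qed

section \<open>Units of the extension ring and the quotient by scalars\<close>

lemma lin_inverse:
  assumes "a \<in> carrier R" "b \<in> carrier R" "Lam R P Q a b \<in> Units R"
  shows "\<exists>y \<in> ext. lin a b \<otimes>\<^bsub>L\<^esub> y = \<one>\<^bsub>L\<^esub>"
proof (rule bexI)
  let ?k = "inv Lam R P Q a b" and ?y = "lin (a \<ominus> b \<otimes> P_ring) (\<ominus> b)"
  have "lin a b \<otimes>\<^bsub>L\<^esub> (?y \<otimes>\<^bsub>L\<^esub> h ?k) = lin a b \<otimes>\<^bsub>L\<^esub> ?y \<otimes>\<^bsub>L\<^esub> h ?k"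
    using assms by (intro S.m_assoc[symmetric] lin_closed hom_closed) auto
  also have "\<dots> = h (Lam R P Q a b \<otimes> ?k)"
    using assms(3) unfolding lin_conj[OF assms(1,2)] by (intro hom_mult[symmetric]) auto
  also have "\<dots> = \<one>\<^bsub>L\<^esub>" using assms(3) by (simp del: hom_mult)
  finally show "lin a b \<otimes>\<^bsub>L\<^esub> (?y \<otimes>\<^bsub>L\<^esub> h ?k) = \<one>\<^bsub>L\<^esub>" .
  show "?y \<otimes>\<^bsub>L\<^esub> h ?k \<in> ext"
    using assms by (intro subringE(6)[OF ext_subring] lin_in_ext hom_in_ext) auto
qed

text \<open>Uniqueness of coordinates turns an equation \<open>x y = 1\<close> in \<open>L\<close>
  into one between coordinate pairs; taking norms shows that the norm of \<open>x\<close> is a unit.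
  Conversely, the conjugate divided by the norm is an inverse.\<close>

lemma Units_ext: "Units (L\<lparr>carrier := ext\<rparr>) = {lin a b | a b. a \<in> carrier R \<and> b \<in> carrier R \<and> Lam R P Q a b \<in> Units R}"
proof (intro equalityI subsetI)
  fix x assume "x \<in> Units (L\<lparr>carrier := ext\<rparr>)"
  then obtain y where "x \<in> ext" "y \<in> ext" "x \<otimes>\<^bsub>L\<^esub> y = \<one>\<^bsub>L\<^esub>"
    by (auto simp: Units_def)
  then obtain a b c d where *: "x = lin a b" "y = lin c d" "a \<in> carrier R" "b \<in> carrier R"
       "c \<in> carrier R" "d \<in> carrier R" "lin a b \<otimes>\<^bsub>L\<^esub> lin c d = \<one>\<^bsub>L\<^esub>"
    unfolding ext_def by blast
  have "lin (prod1 a b c d) (prod0 a b c d) = lin \<one> \<zero>"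
    unfolding lin_prod[OF *(3-6)] *(7) by simp
  hence "prod1 a b c d = \<one>" "prod0 a b c d = \<zero>"
    using * by (subst (asm) lin_inj; simp)+
  hence "Lam R P Q a b \<otimes> Lam R P Q c d = \<one>"
    using Lam_prod[OF *(3-6)] by (simp add: Lam_one_zero)
  hence "Lam R P Q a b \<in> Units R"
    using * by (metis Lam_closed Units_one_closed unit_factor)
  thus "x \<in> {lin a b | a b. a \<in> carrier R \<and> b \<in> carrier R \<and> Lam R P Q a b \<in> Units R}"
    using * by blast
next
  fix x assume "x \<in> {lin a b | a b. a \<in> carrier R \<and> b \<in> carrier R \<and> Lam R P Q a b \<in> Units R}"
  then obtain a b where ab: "a \<in> carrier R" "b \<in> carrier R" "Lam R P Q a b \<in> Units R" and x: "x = lin a b"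
    by blast
  obtain y where "y \<in> ext" "x \<otimes>\<^bsub>L\<^esub> y = \<one>\<^bsub>L\<^esub>"
    using lin_inverse[OF ab] x by blast
  moreover have "x \<in> ext" using ab x lin_in_ext by simp
  moreover from calculation have "y \<otimes>\<^bsub>L\<^esub> x = \<one>\<^bsub>L\<^esub>"
    using S.m_comm[of x y] subringE(1)[OF ext_subring] by force
  ultimately show "x \<in> Units (L\<lparr>carrier := ext\<rparr>)" by (auto simp: Units_def)
qed

text \<open>\<open>h\<close> is injective, as the case of vanishing second coordinates in
  \<open>lin_inj\<close>, so an inverse inside the image pulls back to \<open>R\<close>.\<close>

lemma Units_image: "Units (L\<lparr>carrier := h ` carrier R\<rparr>) = h ` Units R"
proof (intro equalityI subsetI)
  fix x assume "x \<in> Units (L\<lparr>carrier := h ` carrier R\<rparr>)"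
  then obtain a c where *: "x = h a" "a \<in> carrier R" "c \<in> carrier R" "h a \<otimes>\<^bsub>L\<^esub> h c = \<one>\<^bsub>L\<^esub>"
    by (auto simp: Units_def)
  hence "lin (a \<otimes> c) \<zero> = lin \<one> \<zero>" by simp
  hence "a \<otimes> c = \<one>" using * by (subst (asm) lin_inj) simp_all
  hence "a \<in> Units R" using * by (metis Units_one_closed unit_factor)
  thus "x \<in> h ` Units R" using * by blast
next
  fix x assume "x \<in> h ` Units R"
  then obtain a where a: "a \<in> Units R" "x = h a" by blast
  hence "h a \<otimes>\<^bsub>L\<^esub> h (inv a) = \<one>\<^bsub>L\<^esub>" "h (inv a) \<otimes>\<^bsub>L\<^esub> h a = \<one>\<^bsub>L\<^esub>"
    by (simp_all flip: hom_mult add: Units_closed)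
  thus "x \<in> Units (L\<lparr>carrier := h ` carrier R\<rparr>)"
    using a by (auto simp: Units_def[of "L\<lparr>carrier := h ` carrier R\<rparr>"] Units_closed)
qed

text \<open>Two units of \<open>ext\<close> lie in the same coset exactly if they differ by a scalar
  \<open>h k\<close> with \<open>k\<close> a unit of \<open>R\<close>; by uniqueness of coordinates
  this is proportionality of the pairs.\<close>

lemma class_iso_via_ext:
  "class_iso_via R P Q (unit_quot L ext (h ` carrier R))
     (\<lambda>a b. unit_coset L ext (h ` carrier R) (h a \<ominus>\<^bsub>L\<^esub> h b \<otimes>\<^bsub>L\<^esub> \<alpha>))"
proof -
  let ?U = "units_of (L\<lparr>carrier := ext\<rparr>)" and ?B = "h ` Units R"
  have "cring (L\<lparr>carrier := ext\<rparr>)"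
    using S.subcring_iff[OF subringE(1)[OF ext_subring]] S.subcringI'[OF ext_subring] by simp
  then interpret E: cring "L\<lparr>carrier := ext\<rparr>" .
  interpret U: comm_group ?U by (rule E.units_comm_group)
  have U_carrier: "carrier ?U = {lin a b | a b. a \<in> carrier R \<and> b \<in> carrier R \<and> Lam R P Q a b \<in> Units R}"
    by (simp add: units_of_def Units_ext)
  have U_mult: "x \<otimes>\<^bsub>?U\<^esub> y = x \<otimes>\<^bsub>L\<^esub> y" for x y by (simp add: units_of_def)
  have U_one: "\<one>\<^bsub>?U\<^esub> = \<one>\<^bsub>L\<^esub>" by (simp add: units_of_def)
  have Lam_const: "Lam R P Q c \<zero> \<in> Units R" if "c \<in> Units R" for c
    using that Lam_scale[of \<one> \<zero> c] by (simp add: Lam_one_zero Units_closed)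
  have B_sub: "?B \<subseteq> carrier ?U"
  proof
    fix x assume "x \<in> ?B"
    then obtain c where c: "c \<in> Units R" "x = h c" by blast
    hence "x = lin c \<zero>" "c \<in> carrier R" by auto
    thus "x \<in> carrier ?U" unfolding U_carrier using Lam_const[OF c(1)] by blast
  qed
  have sub: "subgroup ?B ?U"
  proof (rule U.subgroupI)
    show "?B \<noteq> {}" by auto
    show "x \<otimes>\<^bsub>?U\<^esub> y \<in> ?B" if xy: "x \<in> ?B" "y \<in> ?B" for x y
    proof -
      obtain c d where "c \<in> Units R" "d \<in> Units R" "x = h c" "y = h d" using xy by blast
      hence "x \<otimes>\<^bsub>?U\<^esub> y = h (c \<otimes> d)" "c \<otimes> d \<in> Units R" by (auto simp: U_mult Units_closed)
      thus ?thesis by blast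
    qed
    show "inv\<^bsub>?U\<^esub> x \<in> ?B" if x: "x \<in> ?B" for x
    proof -
      obtain c where c: "c \<in> Units R" "x = h c" using x by blast
      have "inv\<^bsub>?U\<^esub> x = h (inv c)"
      proof (rule U.comm_inv_char)
        show "x \<otimes>\<^bsub>?U\<^esub> h (inv c) = \<one>\<^bsub>?U\<^esub>"
          using c by (simp add: U_mult U_one Units_closed flip: hom_mult)
      qed (use c B_sub in auto)
      thus ?thesis using c by auto
    qed
  qed (rule B_sub)
  have norm: "?B \<lhd> ?U" by (rule U.subgroup_imp_normal[OF sub])
  show ?thesis
    unfolding unit_quot_def unit_coset_def Units_image lin_def[symmetric]
  proof (rule class_iso_viaI)
    fix y
    show "y \<in> carrier (?U Mod ?B) \<longleftrightarrow> (\<exists>a \<in> carrier R. \<exists>b \<in> carrier R. Lam R P Q a b \<in> Units R \<and>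
            y = ?B #>\<^bsub>?U\<^esub> lin a b)"
      unfolding FactGroup_def RCOSETS_def partial_object.simps U_carrier by blast
  next
    fix a b c d
    assume ab: "a \<in> carrier R" "b \<in> carrier R" and cd: "c \<in> carrier R" "d \<in> carrier R"
      and u: "Lam R P Q a b \<in> Units R" "Lam R P Q c d \<in> Units R"
    have mem: "lin a b \<in> carrier ?U" "lin c d \<in> carrier ?U"
      unfolding U_carrier using ab cd u by blast+
    show "?B #>\<^bsub>?U\<^esub> lin (prod1 a b c d) (prod0 a b c d)
        = (?B #>\<^bsub>?U\<^esub> lin a b) \<otimes>\<^bsub>?U Mod ?B\<^esub> (?B #>\<^bsub>?U\<^esub> lin c d)"
      unfolding lin_prod[OF ab cd] using normal.rcos_sum[OF norm mem]
      by (simp add: FactGroup_def U_mult)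
    have "?B #>\<^bsub>?U\<^esub> lin a b = ?B #>\<^bsub>?U\<^esub> lin c d \<longleftrightarrow> lin a b \<in> ?B #>\<^bsub>?U\<^esub> lin c d"
      using U.repr_independence[OF _ mem(2) sub] U.rcos_self[OF mem(1) sub] by metis
    also have "\<dots> \<longleftrightarrow> (\<exists>k \<in> Units R. lin a b = h k \<otimes>\<^bsub>L\<^esub> lin c d)"
      by (auto simp: r_coset_def U_mult)
    also have "\<dots> \<longleftrightarrow> (\<exists>k \<in> Units R. a = k \<otimes> c \<and> b = k \<otimes> d)"
    proof (rule bex_cong[OF refl])
      fix k assume "k \<in> Units R"
      hence k: "k \<in> carrier R" by auto
      \<comment> \<open>A scalar is the element with coordinates \<open>(k, 0)\<close>, so scaling
        is a special case of the product formula.\<close>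
      have "h k \<otimes>\<^bsub>L\<^esub> lin c d = lin (prod1 k \<zero> c d) (prod0 k \<zero> c d)"
        unfolding lin_prod[OF k zero_closed cd] using k by simp
      also have "\<dots> = lin (k \<otimes> c) (k \<otimes> d)" using k cd by (simp add: a_minus_def)
      finally show "lin a b = h k \<otimes>\<^bsub>L\<^esub> lin c d \<longleftrightarrow> a = k \<otimes> c \<and> b = k \<otimes> d"
        using lin_inj[OF ab] k cd by simp
    qed
    finally show "?B #>\<^bsub>?U\<^esub> lin a b = ?B #>\<^bsub>?U\<^esub> lin c d \<longleftrightarrow> (\<exists>k \<in> Units R. a = k \<otimes> c \<and> b = k \<otimes> d)" .
  qed
qed

lemma generate_ring_eq_ext: "generate_ring L (insert \<alpha> (h ` carrier R)) = ext"
proof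
  show "generate_ring L (insert \<alpha> (h ` carrier R)) \<subseteq> ext"
    using \<alpha>_in_ext hom_in_ext by (intro S.generate_ring_min_subring1[OF _ ext_subring]) auto
  show "ext \<subseteq> generate_ring L (insert \<alpha> (h ` carrier R))"
  proof
    fix x assume "x \<in> ext"
    then obtain a b where "x = lin a b" "a \<in> carrier R" "b \<in> carrier R"
      by (auto simp: ext_def)
    thus "x \<in> generate_ring L (insert \<alpha> (h ` carrier R))"
      unfolding lin_def a_minus_def
      by (auto intro!: generate_ring.eng_add generate_ring.a_inv generate_ring.eng_mult intro: generate_ring.incl)
  qed
qed

text \<open>The point is closure under inverses. If a nonzero element had norm \<open>0\<close>, its
  conjugate would vanish since \<open>L\<close> is a domain, and independence would force both
  coordinates to be \<open>0\<close>. So the norm is nonzero, hence a unit of the field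
  \<open>R\<close>.\<close>

lemma generate_field_eq_ext:
  assumes "field R" "field L"
  shows "generate_field L (insert \<alpha> (h ` carrier R)) = ext"
proof
  interpret L: field L by fact
  interpret K: field R by fact
  show "generate_field L (insert \<alpha> (h ` carrier R)) \<subseteq> ext"
  proof
    fix x assume "x \<in> generate_field L (insert \<alpha> (h ` carrier R))"
    thus "x \<in> ext"
    proof induction
      case (m_inv x)
      obtain a b where ab: "x = lin a b" "a \<in> carrier R" "b \<in> carrier R"
        using m_inv by (auto simp: ext_def)
      have "Lam R P Q a b \<noteq> \<zero>"
      proof
        assume "Lam R P Q a b = \<zero>"
        hence "x \<otimes>\<^bsub>L\<^esub> lin (a \<ominus> b \<otimes> P_ring) (\<ominus> b) = \<zero>\<^bsub>L\<^esub>"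
          using lin_conj[OF ab(2,3)] unfolding ab(1) by simp
        hence "lin (a \<ominus> b \<otimes> P_ring) (\<ominus> b) = \<zero>\<^bsub>L\<^esub>"
          using L.integral[of x "lin (a \<ominus> b \<otimes> P_ring) (\<ominus> b)"] m_inv ab by simp
        hence "a \<ominus> b \<otimes> P_ring = \<zero> \<and> \<ominus> b = \<zero>"
          using ab by (intro indep) (simp_all add: lin_def)
        hence "b = \<zero>" "a = \<zero>" using ab by auto
        thus False using m_inv ab by simp
      qed
      hence "Lam R P Q a b \<in> Units R" using ab by (simp add: K.field_Units)
      then obtain y where "y \<in> ext" "x \<otimes>\<^bsub>L\<^esub> y = \<one>\<^bsub>L\<^esub>"
        using lin_inverse ab by blast
      moreover from this have "inv\<^bsub>L\<^esub> x = y"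
        using subringE(1)[OF ext_subring] m_inv by (intro S.comm_inv_char) auto
      ultimately show ?case by simp
    qed (use \<alpha>_in_ext hom_in_ext subringE[OF ext_subring] in auto)
  qed
  show "ext \<subseteq> generate_field L (insert \<alpha> (h ` carrier R))"
  proof
    fix x assume "x \<in> ext"
    then obtain a b where "x = lin a b" "a \<in> carrier R" "b \<in> carrier R"
      by (auto simp: ext_def)
    thus "x \<in> generate_field L (insert \<alpha> (h ` carrier R))"
      unfolding lin_def a_minus_def
      by (auto intro!: generate_field.eng_add generate_field.a_inv generate_field.eng_mult intro: generate_field.incl)
  qed
qed

end

section \<open>Irreducibility and the base rings\<close>

lemma (in domain) quad_rootsD:
  assumes "quad_roots R P Q \<alpha> \<beta>"
  shows "\<alpha> \<in> carrier R" "\<beta> \<in> carrier R"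
    "\<alpha> \<oplus> \<beta> = [P] \<cdot> \<one>" "\<alpha> \<otimes> \<beta> = [Q] \<cdot> \<one>"
proof -
  show ab[simp]: "\<alpha> \<in> carrier R" "\<beta> \<in> carrier R" using assms by (auto simp: quad_roots_def)
  have "[\<one>, \<ominus> ([P] \<cdot> \<one>), [Q] \<cdot> \<one>] = poly_mult [\<one>, \<ominus> \<alpha>] [\<one>, \<ominus> \<beta>]"
    using assms unfolding quad_roots_def quad_poly_def univ_poly_mult by blast
  also have "\<dots> = [\<one>, \<ominus> \<beta> \<oplus> \<ominus> \<alpha>, \<alpha> \<otimes> \<beta>]"
    \<comment> \<open>Coefficient lists are normalized by dropping leading zeros, which affects the
      partial product with the constant coefficient \<open>\<ominus> \<alpha>\<close> when
      \<open>\<alpha> = \<zero>\<close>.\<close>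
    by (cases "\<alpha> = \<zero>") (simp_all add: l_minus r_minus)
  finally have *: "\<ominus> ([P] \<cdot> \<one>) = \<ominus> \<beta> \<oplus> \<ominus> \<alpha>" "[Q] \<cdot> \<one> = \<alpha> \<otimes> \<beta>" by auto
  from *(1) have "\<ominus> (\<ominus> ([P] \<cdot> \<one>)) = \<ominus> (\<ominus> \<beta> \<oplus> \<ominus> \<alpha>)" by simp
  also have "\<ominus> (\<ominus> \<beta> \<oplus> \<ominus> \<alpha>) = \<alpha> \<oplus> \<beta>" using ab by algebra
  finally show "\<alpha> \<oplus> \<beta> = [P] \<cdot> \<one>" by simp
  show "\<alpha> \<otimes> \<beta> = [Q] \<cdot> \<one>" using * by simp
qed

lemma (in domain) quad_poly_carrier: "quad_poly R P Q \<in> carrier (poly_ring R)"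
  unfolding univ_poly_carrier[symmetric] by (auto simp: polynomial_def quad_poly_def)

lemma (in domain) eval_quad_poly:
  assumes [simp]: "r \<in> carrier R"
  shows "eval (quad_poly R P Q) r = \<zero> \<longleftrightarrow> r \<otimes> r = [P] \<cdot> \<one> \<otimes> r \<ominus> [Q] \<cdot> \<one>"
proof -
  define p where "p = [P] \<cdot> \<one>"
  define q where "q = [Q] \<cdot> \<one>"
  have pq: "p \<in> carrier R" "q \<in> carrier R" by (auto simp: p_def q_def)
  have "eval (quad_poly R P Q) r = r \<otimes> r \<oplus> (\<ominus> p \<otimes> r \<oplus> q)"
    by (simp add: quad_poly_def p_def q_def numeral_2_eq_2)
  also have "\<dots> = r \<otimes> r \<ominus> (p \<otimes> r \<ominus> q)" using assms pq by algebra
  finally show ?thesis by (simp add: p_def q_def)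
qed

text \<open>A root would split off a linear factor, impossible for an irreducible polynomial of
  degree two.\<close>

lemma (in domain) quad_irreducible_no_root:
  assumes "quad_irreducible R P Q" and r: "r \<in> carrier R"
  shows "r \<otimes> r \<noteq> [P] \<cdot> \<one> \<otimes> r \<ominus> [Q] \<cdot> \<one>"
proof
  assume "r \<otimes> r = [P] \<cdot> \<one> \<otimes> r \<ominus> [Q] \<cdot> \<one>"
  hence "is_root (quad_poly R P Q) r"
    using r by (simp add: is_root_def eval_quad_poly) (simp add: quad_poly_def)
  hence "r \<in># roots (quad_poly R P Q)"
    using roots_mem_iff_is_root[OF quad_poly_carrier] by blast
  moreover have "roots (quad_poly R P Q) = {#}"
    using assms(1) by (intro pirreducible_roots quad_poly_carrier) (auto simp: quad_irreducible_def quad_poly_def)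
  ultimately show False by simp
qed

text \<open>Over a field, a nonzero nonunit polynomial has positive degree, so a proper
  factorization of \<open>f\<close> is into two linear factors, and a linear factor has a
  root.\<close>

lemma (in field) not_quad_irreducible_root:
  assumes "\<not> quad_irreducible R P Q"
  shows "\<exists>r \<in> carrier R. r \<otimes> r = [P] \<cdot> \<one> \<otimes> r \<ominus> [Q] \<cdot> \<one>"
proof -
  let ?f = "quad_poly R P Q"
  have "\<exists>q \<in> carrier (poly_ring R). \<exists>r \<in> carrier (poly_ring R). ?f = q \<otimes>\<^bsub>poly_ring R\<^esub> r \<and>
          q \<notin> Units (poly_ring R) \<and> r \<notin> Units (poly_ring R)"
  proof (rule ccontr)
    assume *: "\<not> ?thesis"
    have "pirreducible (carrier R) ?f"
    proof (rule pirreducibleI[OF carrier_is_subring quad_poly_carrier])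
      show "?f \<noteq> []" by (simp add: quad_poly_def)
      show "?f \<notin> Units (poly_ring R)"
        using univ_poly_carrier_units by (auto simp: quad_poly_def)
    qed (use * in blast)
    thus False using assms by (simp add: quad_irreducible_def)
  qed
  then obtain q r where qr: "q \<in> carrier (poly_ring R)" "r \<in> carrier (poly_ring R)"
      "?f = q \<otimes>\<^bsub>poly_ring R\<^esub> r" "q \<notin> Units (poly_ring R)" "r \<notin> Units (poly_ring R)"
    by blast
  have deg_ne: "length x - 1 \<noteq> 0" if x: "x \<in> carrier (poly_ring R)" "x \<noteq> []" "x \<notin> Units (poly_ring R)" for x
  proof
    assume "length x - 1 = 0"
    with x(2) obtain k where k: "x = [k]" by (cases x) auto
    hence "k \<in> carrier R - {\<zero>}"
      using x(1) unfolding univ_poly_carrier[symmetric] polynomial_def by auto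
    thus False using x(3) k univ_poly_carrier_units by blast
  qed
  have f: "poly_mult q r = ?f" using qr(3) by (simp add: univ_poly_mult)
  have pol: "polynomial (carrier R) q" "polynomial (carrier R) r"
    using qr(1,2) by (auto simp: univ_poly_carrier)
  \<comment> \<open>A zero factor would make the degree \<open>0\<close>; this excludes it.\<close>
  have deg: "2 = (if q = [] \<or> r = [] then 0 else (length q - 1) + (length r - 1))"
    using poly_mult_degree_eq[OF carrier_is_subring pol] unfolding f by (simp add: quad_poly_def)
  hence ne: "q \<noteq> []" "r \<noteq> []" by (auto split: if_splits)
  have "length q - 1 = 1" using deg ne deg_ne[OF qr(1) ne(1) qr(4)] deg_ne[OF qr(2) ne(2) qr(5)] by simp
  from degree_one_root[OF carrier_is_subfield qr(1) this]
  obtain x where x: "x \<in> carrier R" "eval q x = \<zero>" by blast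
  have "eval ?f x = eval q x \<otimes> eval r x"
    unfolding qr(3) using ring_hom_mult[OF eval_is_hom[OF carrier_is_subring x(1)] qr(1,2)] .
  moreover have "eval r x \<in> carrier R"
    using ring_hom_closed[OF eval_is_hom[OF carrier_is_subring x(1)] qr(2)] .
  ultimately have "eval ?f x = \<zero>" using x by simp
  thus ?thesis using x(1) eval_quad_poly by blast
qed

lemma (in ring_hom_cring) hom_int_multiple_one:
  fixes k :: int
  shows "h ([k] \<cdot> \<one>) = [k] \<cdot>\<^bsub>S\<^esub> \<one>\<^bsub>S\<^esub>"
proof -
  have "h \<in> hom (add_monoid R) (add_monoid S)" by (rule homI) simp_all
  from hom_int_pow[OF this _ R.add.is_group S.add.is_group, of \<one> k]
  show ?thesis by (simp add: add_pow_def)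
qed

text \<open>Only pairs of unit norm are constrained. This permits replacing the inverse of the ring
  by the total inverse of complex numbers.\<close>

lemma class_iso_via_cong:
  assumes "class_iso_via R P Q H g"
    and "\<And>a b. a \<in> carrier R \<Longrightarrow> b \<in> carrier R \<Longrightarrow> Lam R P Q a b \<in> Units R \<Longrightarrow> g a b = g' a b"
  shows "class_iso_via R P Q H g'"
  using assms unfolding class_iso_via_def by auto

section \<open>Subrings of the complex numbers\<close>

lemma complex_ring_simps [simp]:
  "carrier complex_ring = UNIV" "x \<otimes>\<^bsub>complex_ring\<^esub> y = x * y" "x \<oplus>\<^bsub>complex_ring\<^esub> y = x + y"
  "\<one>\<^bsub>complex_ring\<^esub> = 1" "\<zero>\<^bsub>complex_ring\<^esub> = 0"
  by (simp_all add: ring_of_type_algebra_def)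

interpretation complex: domain complex_ring
  by (rule field.axioms(1)[OF field_from_type_algebra])

lemma complex_uminus [simp]: "\<ominus>\<^bsub>complex_ring\<^esub> x = - x"
  using complex.minus_equality[of "- x" x] by simp

lemma complex_minus [simp]: "x \<ominus>\<^bsub>complex_ring\<^esub> y = x - y"
  by (simp add: a_minus_def)

lemma complex_int_multiple: "[k] \<cdot>\<^bsub>complex_ring\<^esub> 1 = of_int k"
proof -
  have nat: "[n] \<cdot>\<^bsub>complex_ring\<^esub> 1 = of_nat n" for n :: nat
    by (induction n) (simp_all add: complex.add.nat_pow_Suc del: complex.add.nat_pow_Suc2)
  show ?thesis
  proof (cases "k \<ge> 0")
    case True
    then show ?thesis by (simp add: add_pow_int_ge nat)
  next
    case False
    then show ?thesis by (simp add: add_pow_int_lt nat)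
  qed
qed

lemma complex_m_inv: "x \<noteq> 0 \<Longrightarrow> inv\<^bsub>complex_ring\<^esub> x = inverse x"
  by (rule complex.comm_inv_char) auto

locale complex_subring =
  fixes K :: "complex set"
  assumes K_subring: "subring K complex_ring"
begin

abbreviation K_ring where "K_ring \<equiv> complex_ring\<lparr>carrier := K\<rparr>"

lemma K_closed [simp]:
  "0 \<in> K" "1 \<in> K" "x \<in> K \<Longrightarrow> - x \<in> K" "x \<in> K \<Longrightarrow> y \<in> K \<Longrightarrow> x * y \<in> K"
  "x \<in> K \<Longrightarrow> y \<in> K \<Longrightarrow> x + y \<in> K"
  using subringE[OF K_subring] by auto

lemma K_diff [simp]: "x \<in> K \<Longrightarrow> y \<in> K \<Longrightarrow> x - y \<in> K"
  using K_closed(5)[of x "- y"] by simp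

sublocale K: domain K_ring
  by (rule complex.subring_is_domain[OF K_subring])

lemma K_hom: "id \<in> ring_hom K_ring complex_ring"
  by (rule ring_hom_memI) auto

sublocale K_hom: ring_hom_cring K_ring complex_ring id
  by unfold_locales (rule K_hom)

lemma K_int_multiple: "[k] \<cdot>\<^bsub>K_ring\<^esub> 1 = (of_int k :: complex)"
  using K_hom.hom_int_multiple_one[of k] by (simp add: complex_int_multiple)

text \<open>Negation is defined by a description over the carrier, so it does not carry over to a
  subring by definition, unlike sums and products; the inclusion homomorphism transfers it.\<close>

lemma K_uminus: "x \<in> K \<Longrightarrow> \<ominus>\<^bsub>K_ring\<^esub> x = - x"
  using K_hom.hom_a_inv[of x] by simp

lemma K_minus: "y \<in> K \<Longrightarrow> x \<ominus>\<^bsub>K_ring\<^esub> y = x - y"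
  by (simp add: a_minus_def K_uminus[unfolded a_minus_def])

lemma K_Units: "Units K_ring = {x \<in> K. x \<noteq> 0 \<and> inverse x \<in> K}"
proof (intro equalityI subsetI)
  fix x assume "x \<in> Units K_ring"
  then obtain y where "x \<in> K" "y \<in> K" "x * y = 1" by (auto simp: Units_def)
  thus "x \<in> {x \<in> K. x \<noteq> 0 \<and> inverse x \<in> K}" using inverse_unique[of x y] by auto
qed (auto simp: Units_def intro!: bexI[of _ "inverse _"])

lemma K_m_inv: "x \<in> Units K_ring \<Longrightarrow> inv\<^bsub>K_ring\<^esub> x = inverse x"
  by (rule K.comm_inv_char) (auto simp: K_Units)

text \<open>Cancellation holds because the roots are distinct complex numbers. For pairs of unit
  norm, \<open>a - b * \<theta>\<^sub>2\<close> is a unit of \<open>K\<close>, so that its inverse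
  in \<open>K\<close> is the complex one.\<close>

lemma class_iso_via_split:
  assumes "of_int Q \<in> Units K_ring" and \<theta>: "\<theta>\<^sub>1 \<in> K" "\<theta>\<^sub>2 \<in> K"
    and sum: "\<theta>\<^sub>1 + \<theta>\<^sub>2 = of_int P" and prd: "\<theta>\<^sub>1 * \<theta>\<^sub>2 = of_int Q" and ne: "\<theta>\<^sub>1 \<noteq> \<theta>\<^sub>2"
    and carrier_H: "carrier H = {u \<in> Units K_ring. \<exists>x \<in> K. u = 1 + (\<theta>\<^sub>2 - \<theta>\<^sub>1) * x}"
    and mult_H: "\<And>x y. x \<otimes>\<^bsub>H\<^esub> y = x * y"
  shows "class_iso_via K_ring P Q H (\<lambda>a b. (a - b * \<theta>\<^sub>1) * inverse (a - b * \<theta>\<^sub>2))"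
proof -
  interpret quad_ring K_ring P Q
    by unfold_locales (simp add: K_int_multiple assms(1))
  have *: "\<theta>\<^sub>1 \<in> carrier K_ring" "\<theta>\<^sub>2 \<in> carrier K_ring" "\<theta>\<^sub>1 \<oplus>\<^bsub>K_ring\<^esub> \<theta>\<^sub>2 = P_ring" "\<theta>\<^sub>1 \<otimes>\<^bsub>K_ring\<^esub> \<theta>\<^sub>2 = Q_ring"
    using \<theta> sum prd by (simp_all add: K_int_multiple)
  show ?thesis
  proof (rule class_iso_via_cong[OF class_iso_via_split[OF *, of H]])
    fix a b assume ab: "a \<in> carrier K_ring" "b \<in> carrier K_ring" "Lam K_ring P Q a b \<in> Units K_ring"
    hence "a - b * \<theta>\<^sub>2 \<in> Units K_ring"
      using Lam_split_Units_iff[OF *] \<theta> by (simp add: K_minus)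
    thus "(a \<ominus>\<^bsub>K_ring\<^esub> b \<otimes>\<^bsub>K_ring\<^esub> \<theta>\<^sub>1) \<otimes>\<^bsub>K_ring\<^esub> inv\<^bsub>K_ring\<^esub> (a \<ominus>\<^bsub>K_ring\<^esub> b \<otimes>\<^bsub>K_ring\<^esub> \<theta>\<^sub>2)
       = (a - b * \<theta>\<^sub>1) * inverse (a - b * \<theta>\<^sub>2)"
      using ab \<theta> by (simp add: K_minus K_m_inv)
  qed (use \<theta> ne in \<open>auto simp: carrier_H mult_H K_minus\<close>)
qed

text \<open>A relation \<open>a = b * \<theta>\<close> with \<open>b \<noteq> 0\<close> and rational
  \<open>a\<close>, \<open>b\<close> would make \<open>\<theta>\<close> rational.\<close>

lemma quad_ext_complex:
  assumes "of_int Q \<in> Units K_ring" and "K \<subseteq> \<rat>" and "\<theta> \<notin> \<rat>"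
    and "\<theta> * \<theta> = of_int P * \<theta> - of_int Q"
  shows "quad_ext K_ring P Q complex_ring id \<theta>"
proof unfold_locales
  fix a b assume ab: "a \<in> carrier K_ring" "b \<in> carrier K_ring"
    and "id a \<ominus>\<^bsub>complex_ring\<^esub> id b \<otimes>\<^bsub>complex_ring\<^esub> \<theta> = \<zero>\<^bsub>complex_ring\<^esub>"
  hence eq: "a = b * \<theta>" by simp
  have "b = 0"
  proof (rule ccontr)
    assume "b \<noteq> 0"
    hence "\<theta> = a / b" using eq by simp
    moreover have "a \<in> \<rat>" "b \<in> \<rat>" using ab assms(2) by auto
    ultimately show False using assms(3) by (metis Rats_divide)
  qed
  thus "a = \<zero>\<^bsub>K_ring\<^esub> \<and> b = \<zero>\<^bsub>K_ring\<^esub>" using eq by simp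
qed (use assms K_hom in \<open>auto simp: K_int_multiple\<close>)

end

section \<open>The rational numbers and rational roots\<close>

lemma complex_subring_Rats: "complex_subring \<rat>"
  by (rule complex_subring.intro, rule complex.subringI) auto

lemma field_rat_ring: "field (complex_ring\<lparr>carrier := \<rat>\<rparr>)"
proof -
  have "subfield \<rat> complex_ring"
    by (rule field.subfieldI'[OF field_from_type_algebra]) (auto simp: complex_m_inv complex_subring.K_subring[OF complex_subring_Rats])
  thus ?thesis by (rule complex.subfield_iff(2))
qed

lemma Units_rat_ring: "Units (complex_ring\<lparr>carrier := \<rat>\<rparr>) = \<rat> - {0}"
  using complex_subring.K_Units[OF complex_subring_Rats] by auto

text \<open>A root of a monic integer polynomial is an algebraic integer, and rational algebraic
  integers are integers.\<close>

lemma quadratic_rational_root_int: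
  fixes x :: complex
  assumes "x \<in> \<rat>" "x * x = of_int P * x - of_int Q"
  shows "x \<in> \<int>"
proof (rule rational_algebraic_int_is_int[OF _ assms(1)], rule algebraic_int.intros)
  let ?p = "[:of_int Q, - of_int P, 1:] :: complex poly"
  show "Polynomial.lead_coeff ?p = 1" by simp
  show "\<forall>i. Polynomial.coeff ?p i \<in> \<int>"
    by (auto simp: coeff_pCons split: nat.split)
  show "poly ?p x = 0" using assms(2) by (simp add: algebra_simps)
qed

section \<open>Localization at a prime\<close>

context
  fixes p :: nat
  assumes p: "Factorial_Ring.prime p"
begin

lemma prime_int_p: "Factorial_Ring.prime (int p)"
  using p by simp

lemma Z_locI: "\<not> int p dvd b \<Longrightarrow> of_int a / of_int b \<in> Z_loc p"
  by (auto simp: Z_loc_def)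

lemma Z_locE:
  assumes "x \<in> Z_loc p"
  obtains a b where "x = of_int a / of_int b" "\<not> int p dvd b" "b \<noteq> 0"
  using assms unfolding Z_loc_def by force

lemma Z_loc_of_int: "of_int a \<in> Z_loc p"
  using Z_locI[of 1 a] prime_int_p not_prime_unit by force

lemma complex_subring_Z_loc: "complex_subring (Z_loc p)"
proof (rule complex_subring.intro, rule complex.subringI)
  show "\<one>\<^bsub>complex_ring\<^esub> \<in> Z_loc p" using Z_loc_of_int[of 1] by simp
  show "\<ominus>\<^bsub>complex_ring\<^esub> x \<in> Z_loc p" if "x \<in> Z_loc p" for x
  proof -
    obtain a b where ab: "x = of_int a / of_int b" "\<not> int p dvd b" using \<open>x \<in> Z_loc p\<close> by (rule Z_locE)
    thus ?thesis using Z_locI[of b "- a"] by simp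
  qed
  show "x \<otimes>\<^bsub>complex_ring\<^esub> y \<in> Z_loc p" "x \<oplus>\<^bsub>complex_ring\<^esub> y \<in> Z_loc p"
    if xy: "x \<in> Z_loc p" "y \<in> Z_loc p" for x y
  proof -
    obtain a b where ab: "x = of_int a / of_int b" "\<not> int p dvd b" "b \<noteq> 0" using xy(1) by (rule Z_locE)
    obtain c d where cd: "y = of_int c / of_int d" "\<not> int p dvd d" "d \<noteq> 0" using xy(2) by (rule Z_locE)
    have "\<not> int p dvd b * d" using ab cd prime_int_p prime_dvd_mult_iff by blast
    note in_loc = Z_locI[OF this]
    have "x * y = of_int (a * c) / of_int (b * d)" "x + y = of_int (a * d + c * b) / of_int (b * d)"
      using ab cd by (simp_all add: add_frac_eq)
    thus "x \<otimes>\<^bsub>complex_ring\<^esub> y \<in> Z_loc p" "x \<oplus>\<^bsub>complex_ring\<^esub> y \<in> Z_loc p"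
      using in_loc by (simp_all only: complex_ring_simps)
  qed
qed simp

lemma Z_loc_subset_Rats: "Z_loc p \<subseteq> \<rat>"
  by (auto simp: Z_loc_def)

lemma Units_Z_locI:
  assumes "\<not> int p dvd a" "\<not> int p dvd b"
  shows "of_int a / of_int b \<in> Units (complex_ring\<lparr>carrier := Z_loc p\<rparr>)"
  unfolding complex_subring.K_Units[OF complex_subring_Z_loc]
  using assms Z_locI[of b a] Z_locI[of a b] by force

lemma Units_Z_loc_of_int:
  assumes "\<not> int p dvd a"
  shows "of_int a \<in> Units (complex_ring\<lparr>carrier := Z_loc p\<rparr>)"
  using Units_Z_locI[OF assms, of 1] prime_int_p not_prime_unit by force

text \<open>With \<open>x = a / b\<close>, the numerator \<open>b + p^k a\<close> is congruent to
  \<open>b\<close> modulo \<open>p\<close>, hence prime to \<open>p\<close>. So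
  \<open>1 + p^k Z_(p)\<close> consists of units for \<open>k > 0\<close>.\<close>

lemma Units_Z_loc_one_plus:
  assumes x: "x \<in> Z_loc p" and k: "k > 0"
  shows "1 + of_nat p ^ k * x \<in> Units (complex_ring\<lparr>carrier := Z_loc p\<rparr>)"
proof -
  obtain a b where ab: "x = of_int a / of_int b" "\<not> int p dvd b" "b \<noteq> 0" using x by (rule Z_locE)
  have "int p dvd int p ^ k * a" using k by simp
  hence "\<not> int p dvd b + int p ^ k * a" using ab(2) dvd_add_left_iff by blast
  moreover have "1 + of_nat p ^ k * x = of_int (b + int p ^ k * a) / of_int b"
    using ab by (simp add: add_divide_distrib)
  ultimately show ?thesis using Units_Z_locI[OF _ ab(2)] by presburger
qed

end

section \<open>Residue rings and extensions of fields\<close>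

lemma residue_ring_int_multiple:
  assumes "m > 1"
  shows "[k] \<cdot>\<^bsub>residue_ring m\<^esub> \<one>\<^bsub>residue_ring m\<^esub> = k mod m"
proof -
  interpret residues m "residue_ring m" by unfold_locales (use assms in auto)
  have nat: "[n] \<cdot>\<^bsub>residue_ring m\<^esub> \<one>\<^bsub>residue_ring m\<^esub> = int n mod m" for n :: nat
  proof (induction n)
    case (Suc n)
    have "[Suc n] \<cdot>\<^bsub>residue_ring m\<^esub> \<one>\<^bsub>residue_ring m\<^esub> = (int n mod m + 1) mod m"
      using Suc by (simp add: add.nat_pow_Suc res_add_eq res_one_eq)
    thus ?case by (simp add: mod_simps algebra_simps)
  qed (simp add: res_zero_eq)
  show ?thesis
  proof (cases "k \<ge> 0")
    case True
    then show ?thesis by (simp add: add_pow_int_ge nat)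
  next
    case False
    then show ?thesis by (simp add: add_pow_int_lt nat res_neg_eq mod_simps)
  qed
qed

text \<open>If \<open>b\<close> were nonzero, then \<open>\<alpha> = h r\<close> with
  \<open>r = a / b\<close>. As a homomorphism of fields is injective, the quadratic equation would
  pull back to \<open>R\<close> and make \<open>r\<close> a root there.\<close>

lemma field_hom_lin_indep:
  assumes "field R" "field L" and h: "h \<in> ring_hom R L"
    and [simp]: "\<alpha> \<in> carrier L" "p \<in> carrier R" "q \<in> carrier R"
    and root: "\<alpha> \<otimes>\<^bsub>L\<^esub> \<alpha> = h p \<otimes>\<^bsub>L\<^esub> \<alpha> \<ominus>\<^bsub>L\<^esub> h q"
    and no_root: "\<And>r. r \<in> carrier R \<Longrightarrow> r \<otimes>\<^bsub>R\<^esub> r \<noteq> p \<otimes>\<^bsub>R\<^esub> r \<ominus>\<^bsub>R\<^esub> q"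
    and a: "a \<in> carrier R" and b: "b \<in> carrier R"
    and zero: "h a \<ominus>\<^bsub>L\<^esub> h b \<otimes>\<^bsub>L\<^esub> \<alpha> = \<zero>\<^bsub>L\<^esub>"
  shows "a = \<zero>\<^bsub>R\<^esub> \<and> b = \<zero>\<^bsub>R\<^esub>"
proof -
  interpret R: field R by fact
  interpret L: field L by fact
  interpret ring_hom_cring R L h by unfold_locales (rule h)
  have inj: "x = \<zero>\<^bsub>R\<^esub>" if "x \<in> carrier R" "h x = \<zero>\<^bsub>L\<^esub>" for x
  proof (rule ccontr)
    assume "x \<noteq> \<zero>\<^bsub>R\<^esub>"
    hence "x \<in> Units R" using that by (simp add: R.field_Units)
    hence "h (x \<otimes>\<^bsub>R\<^esub> inv\<^bsub>R\<^esub> x) = \<one>\<^bsub>L\<^esub>" "inv\<^bsub>R\<^esub> x \<in> carrier R" by (simp_all del: hom_mult)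
    thus False using that by simp
  qed
  have ha: "h a = h b \<otimes>\<^bsub>L\<^esub> \<alpha>" by (rule L.eq_by_diff[OF zero]) (use a b in simp_all)
  have "b = \<zero>\<^bsub>R\<^esub>"
  proof (rule ccontr)
    assume "b \<noteq> \<zero>\<^bsub>R\<^esub>"
    hence bu: "b \<in> Units R" using b by (simp add: R.field_Units)
    define r where "r = inv\<^bsub>R\<^esub> b \<otimes>\<^bsub>R\<^esub> a"
    have r[simp]: "r \<in> carrier R" using bu a by (simp add: r_def)
    have "h r = h (inv\<^bsub>R\<^esub> b) \<otimes>\<^bsub>L\<^esub> (h b \<otimes>\<^bsub>L\<^esub> \<alpha>)"
      using bu a by (simp add: r_def ha)
    also have "\<dots> = h (inv\<^bsub>R\<^esub> b \<otimes>\<^bsub>R\<^esub> b) \<otimes>\<^bsub>L\<^esub> \<alpha>"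
      unfolding hom_mult[OF R.Units_inv_closed[OF bu] b] using bu b by (simp add: L.m_assoc)
    finally have hr: "h r = \<alpha>" using bu by (simp del: hom_mult)
    have "h (r \<otimes>\<^bsub>R\<^esub> r \<ominus>\<^bsub>R\<^esub> (p \<otimes>\<^bsub>R\<^esub> r \<ominus>\<^bsub>R\<^esub> q))
        = \<alpha> \<otimes>\<^bsub>L\<^esub> \<alpha> \<ominus>\<^bsub>L\<^esub> (h p \<otimes>\<^bsub>L\<^esub> \<alpha> \<ominus>\<^bsub>L\<^esub> h q)"
      by (simp add: a_minus_def hr)
    also have "\<dots> = \<zero>\<^bsub>L\<^esub>" by (simp add: root)
    finally have "r \<otimes>\<^bsub>R\<^esub> r \<ominus>\<^bsub>R\<^esub> (p \<otimes>\<^bsub>R\<^esub> r \<ominus>\<^bsub>R\<^esub> q) = \<zero>\<^bsub>R\<^esub>" by (intro inj) simp_all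
    hence "r \<otimes>\<^bsub>R\<^esub> r = p \<otimes>\<^bsub>R\<^esub> r \<ominus>\<^bsub>R\<^esub> q" by (rule R.eq_by_diff) simp_all
    thus False using no_root[OF r] by contradiction
  qed
  moreover from this have "a = \<zero>\<^bsub>R\<^esub>" using ha a by (intro inj) simp_all
  ultimately show ?thesis by simp
qed

section \<open>The isomorphisms over \<open>Q\<close>, \<open>Z_(p)\<close> and
  \<open>F_p\<close>\<close>

theorem theorem5:
  fixes P Q D\<^sub>0 :: int and p s :: nat and \<theta>\<^sub>1 \<theta>\<^sub>2 :: complex
  assumes "Q \<noteq> 0"
    and "quad_roots complex_ring P Q \<theta>\<^sub>1 \<theta>\<^sub>2"
    and "P\<^sup>2 - 4 * Q \<noteq> 0"
    and "Factorial_Ring.prime p" and "\<not> int p dvd Q"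
    and "P\<^sup>2 - 4 * Q = int p ^ s * D\<^sub>0" and "\<not> int p dvd D\<^sub>0"
  shows
    "(quad_irreducible rat_ring P Q \<longrightarrow>
        class_iso_via rat_ring P Q
          (unit_quot complex_ring (generate_field complex_ring (insert \<theta>\<^sub>1 \<rat>)) \<rat>)
          (\<lambda>a b. unit_coset complex_ring (generate_field complex_ring (insert \<theta>\<^sub>1 \<rat>)) \<rat> (a - b * \<theta>\<^sub>1)))
   \<and> (\<not> quad_irreducible rat_ring P Q \<longrightarrow>
        class_iso_via rat_ring P Q
          (units_of rat_ring)
          (\<lambda>a b. (a - b * \<theta>\<^sub>1) * inverse (a - b * \<theta>\<^sub>2)))
   \<and> (quad_irreducible rat_ring P Q \<longrightarrow>
        class_iso_via (Z_loc_ring p) P Q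
          (unit_quot complex_ring (generate_ring complex_ring (insert \<theta>\<^sub>1 (Z_loc p))) (Z_loc p))
          (\<lambda>a b. unit_coset complex_ring (generate_ring complex_ring (insert \<theta>\<^sub>1 (Z_loc p))) (Z_loc p) (a - b * \<theta>\<^sub>1)))
   \<and> (\<not> quad_irreducible rat_ring P Q \<and> \<not> int p dvd P\<^sup>2 - 4 * Q \<longrightarrow>
        class_iso_via (Z_loc_ring p) P Q
          (units_of (Z_loc_ring p))
          (\<lambda>a b. (a - b * \<theta>\<^sub>1) * inverse (a - b * \<theta>\<^sub>2)))
   \<and> (\<not> quad_irreducible rat_ring P Q \<and> int p dvd P\<^sup>2 - 4 * Q \<longrightarrow>
        class_iso_via (Z_loc_ring p) P Q
          ((units_of (Z_loc_ring p))\<lparr>carrier := {1 + of_nat p ^ (s div 2) * x | x. x \<in> Z_loc p}\<rparr>)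
          (\<lambda>a b. (a - b * \<theta>\<^sub>1) * inverse (a - b * \<theta>\<^sub>2)))
   \<and> (quad_irreducible (residue_field p) P Q \<longrightarrow>
        (\<forall>(L :: 'l ring) h \<alpha> \<beta>. field L \<and> h \<in> ring_hom (residue_field p) L \<and> quad_roots L P Q \<alpha> \<beta> \<longrightarrow>
          class_iso_via (residue_field p) P Q
            (unit_quot L (generate_field L (insert \<alpha> (h ` carrier (residue_field p)))) (h ` carrier (residue_field p)))
            (\<lambda>a b. unit_coset L (generate_field L (insert \<alpha> (h ` carrier (residue_field p)))) (h ` carrier (residue_field p))
                     (h a \<ominus>\<^bsub>L\<^esub> h b \<otimes>\<^bsub>L\<^esub> \<alpha>))))
   \<and> (\<not> quad_irreducible (residue_field p) P Q \<and> \<not> int p dvd P\<^sup>2 - 4 * Q \<longrightarrow>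
        (\<forall>\<alpha> \<beta>. quad_roots (residue_field p) P Q \<alpha> \<beta> \<longrightarrow>
          class_iso_via (residue_field p) P Q
            (units_of (residue_field p))
            (\<lambda>a b. (a \<ominus>\<^bsub>residue_field p\<^esub> b \<otimes>\<^bsub>residue_field p\<^esub> \<alpha>) \<otimes>\<^bsub>residue_field p\<^esub> inv\<^bsub>residue_field p\<^esub> (a \<ominus>\<^bsub>residue_field p\<^esub> b \<otimes>\<^bsub>residue_field p\<^esub> \<beta>))))
   \<and> (\<not> quad_irreducible (residue_field p) P Q \<and> int p dvd P\<^sup>2 - 4 * Q \<longrightarrow>
        (\<forall>\<alpha>. quad_roots (residue_field p) P Q \<alpha> \<alpha> \<longrightarrow>
          class_iso_via (residue_field p) P Q
            (add_monoid (residue_field p))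
            (\<lambda>a b. \<ominus>\<^bsub>residue_field p\<^esub> b \<otimes>\<^bsub>residue_field p\<^esub> inv\<^bsub>residue_field p\<^esub> (a \<ominus>\<^bsub>residue_field p\<^esub> b \<otimes>\<^bsub>residue_field p\<^esub> \<alpha>))))"
proof -
  interpret Q: complex_subring \<rat> by (rule complex_subring_Rats)
  interpret Z: complex_subring "Z_loc p" by (rule complex_subring_Z_loc[OF assms(4)])
  interpret F: residues_prime p "residue_field p"
    by unfold_locales (use assms(4) in auto)
  have p1: "int p > 1" using assms(4) prime_gt_1_nat by auto
  have sum: "\<theta>\<^sub>1 + \<theta>\<^sub>2 = of_int P" and prd: "\<theta>\<^sub>1 * \<theta>\<^sub>2 = of_int Q"
    using complex.quad_rootsD[OF assms(2)] by (simp_all add: complex_int_multiple)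
  \<comment> \<open>This gives distinctness of the roots now and the \<open>p\<close>-adic valuation
    of their difference later.\<close>
  have disc: "(\<theta>\<^sub>2 - \<theta>\<^sub>1) ^ 2 = of_int (P\<^sup>2 - 4 * Q)"
    unfolding of_int_diff of_int_power of_int_mult sum[symmetric] prd[symmetric]
    by (simp add: power2_eq_square algebra_simps)
  have ne: "\<theta>\<^sub>1 \<noteq> \<theta>\<^sub>2"
  proof
    assume "\<theta>\<^sub>1 = \<theta>\<^sub>2"
    hence "of_int (P\<^sup>2 - 4 * Q) = (0 :: complex)" using disc by simp
    thus False using assms(3) of_int_eq_0_iff by blast
  qed
  have root: "\<theta>\<^sub>1 * \<theta>\<^sub>1 = of_int P * \<theta>\<^sub>1 - of_int Q"
    unfolding sum[symmetric] prd[symmetric] by (simp add: algebra_simps)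
  have root2: "\<theta>\<^sub>2 * \<theta>\<^sub>2 = of_int P * \<theta>\<^sub>2 - of_int Q"
    unfolding sum[symmetric] prd[symmetric] by (simp add: algebra_simps)
  have Q_unit_Rats: "of_int Q \<in> Units Q.K_ring"
    using assms(1) by (simp add: Units_rat_ring)
  have Q_unit_Z: "of_int Q \<in> Units Z.K_ring"
    by (rule Units_Z_loc_of_int[OF assms(4,5)])

  have irr: "\<theta>\<^sub>1 \<notin> \<rat>" if "quad_irreducible rat_ring P Q"
    using Q.K.quad_irreducible_no_root[of P Q \<theta>\<^sub>1] that root
    by (auto simp: rat_ring_def Q.K_int_multiple Q.K_minus)
  have red: "\<theta>\<^sub>1 \<in> \<int> \<and> \<theta>\<^sub>2 \<in> \<int>" if nirr: "\<not> quad_irreducible rat_ring P Q"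
  proof -
    \<comment> \<open>A reducible \<open>f\<close> has a rational root, which must be
      \<open>\<theta>\<^sub>1\<close> or \<open>\<theta>\<^sub>2\<close>; the other one is
      \<open>P\<close> minus it. Being rational, both are integers.\<close>
    obtain x :: complex where x: "x \<in> \<rat>" "x * x = of_int P * x - of_int Q"
      using field.not_quad_irreducible_root[OF field_rat_ring, of P Q] nirr
      by (auto simp: rat_ring_def Q.K_int_multiple Q.K_minus)
    have "(x - \<theta>\<^sub>1) * (x - \<theta>\<^sub>2) = 0"
      using x(2) unfolding sum[symmetric] prd[symmetric] by (simp add: algebra_simps)
    hence "\<theta>\<^sub>1 \<in> \<rat> \<or> \<theta>\<^sub>2 \<in> \<rat>" using x(1) by auto
    moreover have "\<theta>\<^sub>2 = of_int P - \<theta>\<^sub>1" "\<theta>\<^sub>1 = of_int P - \<theta>\<^sub>2" using sum by (auto simp: algebra_simps)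
    ultimately have "\<theta>\<^sub>1 \<in> \<rat>" "\<theta>\<^sub>2 \<in> \<rat>" by (metis Rats_diff Rats_of_int)+
    thus ?thesis using quadratic_rational_root_int root root2 by blast
  qed

  have part1: "class_iso_via rat_ring P Q
          (unit_quot complex_ring (generate_field complex_ring (insert \<theta>\<^sub>1 \<rat>)) \<rat>)
          (\<lambda>a b. unit_coset complex_ring (generate_field complex_ring (insert \<theta>\<^sub>1 \<rat>)) \<rat> (a - b * \<theta>\<^sub>1))"
    if "quad_irreducible rat_ring P Q"
  proof -
    interpret E: quad_ext Q.K_ring P Q complex_ring id \<theta>\<^sub>1
      by (rule Q.quad_ext_complex[OF Q_unit_Rats subset_refl irr[OF that] root])
    show ?thesis
      using E.class_iso_via_ext E.generate_field_eq_ext[OF field_rat_ring field_from_type_algebra]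
      by (simp add: rat_ring_def)
  qed

  have part2: "class_iso_via (Z_loc_ring p) P Q
          (unit_quot complex_ring (generate_ring complex_ring (insert \<theta>\<^sub>1 (Z_loc p))) (Z_loc p))
          (\<lambda>a b. unit_coset complex_ring (generate_ring complex_ring (insert \<theta>\<^sub>1 (Z_loc p))) (Z_loc p) (a - b * \<theta>\<^sub>1))"
    if "quad_irreducible rat_ring P Q"
  proof -
    interpret E: quad_ext Z.K_ring P Q complex_ring id \<theta>\<^sub>1
      by (rule Z.quad_ext_complex[OF Q_unit_Z Z_loc_subset_Rats[OF assms(4)] irr[OF that] root])
    show ?thesis
      using E.class_iso_via_ext E.generate_ring_eq_ext by (simp add: Z_loc_ring_def)
  qed

  have part1': "class_iso_via rat_ring P Q (units_of rat_ring)
          (\<lambda>a b. (a - b * \<theta>\<^sub>1) * inverse (a - b * \<theta>\<^sub>2))"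
    if "\<not> quad_irreducible rat_ring P Q"
    unfolding rat_ring_def
  proof (rule Q.class_iso_via_split[OF Q_unit_Rats _ _ sum prd ne])
    show \<theta>: "\<theta>\<^sub>1 \<in> \<rat>" "\<theta>\<^sub>2 \<in> \<rat>" using red[OF that] Ints_subset_Rats by auto
    \<comment> \<open>The modulus \<open>\<theta>\<^sub>2 - \<theta>\<^sub>1\<close> is a unit of
      \<open>\<rat>\<close>, so the congruence imposes nothing.\<close>
    have "\<exists>x \<in> \<rat>. u = 1 + (\<theta>\<^sub>2 - \<theta>\<^sub>1) * x" if "u \<in> \<rat>" for u
      using that \<theta> ne by (intro bexI[of _ "(u - 1) / (\<theta>\<^sub>2 - \<theta>\<^sub>1)"]) auto
    thus "carrier (units_of Q.K_ring) = {u \<in> Units Q.K_ring. \<exists>x \<in> \<rat>. u = 1 + (\<theta>\<^sub>2 - \<theta>\<^sub>1) * x}"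
      by (auto simp: units_of_def Units_rat_ring)
  qed (simp add: units_of_def)

  \<comment> \<open>The integer \<open>\<theta>\<^sub>2 - \<theta>\<^sub>1\<close> squares to
    \<open>p^s D\<^sub>0\<close>, so \<open>s\<close> is twice its valuation; in particular
    \<open>s\<close> is even and \<open>s div 2\<close> is exactly \<open>s / 2\<close>.\<close>
  have valuation: "\<exists>u. \<theta>\<^sub>2 - \<theta>\<^sub>1 = of_nat p ^ (s div 2) * of_int u \<and> \<not> int p dvd u \<and> even s"
    if nirr: "\<not> quad_irreducible rat_ring P Q"
  proof -
    obtain m n where mn: "\<theta>\<^sub>1 = of_int m" "\<theta>\<^sub>2 = of_int n" using red[OF nirr] by (metis Ints_cases)
    define e where "e = n - m"
    have "of_int (e ^ 2) = (of_int (P\<^sup>2 - 4 * Q) :: complex)" using disc by (simp add: mn e_def)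
    hence e2: "e ^ 2 = int p ^ s * D\<^sub>0" using assms(6) of_int_eq_iff by metis
    have "e \<noteq> 0" using ne by (auto simp: e_def mn)
    moreover have pp: "Factorial_Ring.prime (int p)" using assms(4) by simp
    moreover have "\<not> is_unit (int p)" using pp not_prime_unit by blast
    ultimately obtain u where u: "e = int p ^ multiplicity (int p) e * u" "\<not> int p dvd u"
      using multiplicity_decompose'[of e "int p"] by blast
    define k where "k = multiplicity (int p) e"
    have nu: "\<not> int p dvd u ^ 2" using u(2) pp prime_dvd_power by blast
    have eq: "int p ^ s * D\<^sub>0 = int p ^ (2 * k) * u ^ 2"
      unfolding e2[symmetric] by (subst u(1)) (simp add: k_def power_mult_distrib power_mult[symmetric] mult.commute)
    have val: "multiplicity (int p) (int p ^ n * x) = n" if "\<not> int p dvd x" for n x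
      using that pp by (intro multiplicity_eqI) (auto simp: dvd_mult_cancel_left)
    have "multiplicity (int p) (int p ^ s * D\<^sub>0) = s"
      "multiplicity (int p) (int p ^ (2 * k) * u ^ 2) = 2 * k"
      by (rule val[OF assms(7)], rule val[OF nu])
    hence s: "s = 2 * k" using eq by simp
    have "\<theta>\<^sub>2 - \<theta>\<^sub>1 = of_int e" by (simp add: e_def mn)
    also have "\<dots> = of_nat p ^ k * of_int u" by (subst u(1)) (simp add: k_def)
    finally show ?thesis using s u(2) by auto
  qed

  have split_Z: "class_iso_via (Z_loc_ring p) P Q H (\<lambda>a b. (a - b * \<theta>\<^sub>1) * inverse (a - b * \<theta>\<^sub>2))"
    if nirr: "\<not> quad_irreducible rat_ring P Q"
      and H: "carrier H = {x \<in> Units Z.K_ring. \<exists>y \<in> Z_loc p. x = 1 + of_nat p ^ (s div 2) * y}"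
        "\<And>x y. x \<otimes>\<^bsub>H\<^esub> y = x * y" for H
    unfolding Z_loc_ring_def
  proof (rule Z.class_iso_via_split[OF Q_unit_Z _ _ sum prd ne _ H(2)])
    show "\<theta>\<^sub>1 \<in> Z_loc p" "\<theta>\<^sub>2 \<in> Z_loc p"
      using red[OF nirr] Z_loc_of_int[OF assms(4)] by (auto elim!: Ints_cases)
    obtain u where u: "\<theta>\<^sub>2 - \<theta>\<^sub>1 = of_nat p ^ (s div 2) * of_int u" "\<not> int p dvd u"
      using valuation[OF nirr] by blast
    have "of_int u \<in> Units Z.K_ring" by (rule Units_Z_loc_of_int[OF assms(4) u(2)])
    hence u': "of_int u \<in> Z_loc p" "inverse (of_int u) \<in> Z_loc p" "of_int u \<noteq> (0::complex)"
      by (auto simp: Z.K_Units)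
    \<comment> \<open>The two moduli differ by the factor \<open>u\<close>, a unit of
      \<open>Z_(p)\<close>, hence define the same congruence.\<close>
    have "(\<exists>y \<in> Z_loc p. x = 1 + of_nat p ^ (s div 2) * y) \<longleftrightarrow> (\<exists>y \<in> Z_loc p. x = 1 + (\<theta>\<^sub>2 - \<theta>\<^sub>1) * y)" for x
    proof
      assume "\<exists>y \<in> Z_loc p. x = 1 + of_nat p ^ (s div 2) * y"
      then obtain y where "y \<in> Z_loc p" "x = 1 + of_nat p ^ (s div 2) * y" by blast
      thus "\<exists>y \<in> Z_loc p. x = 1 + (\<theta>\<^sub>2 - \<theta>\<^sub>1) * y"
        using u' by (intro bexI[of _ "inverse (of_int u) * y"]) (simp_all add: u(1))
    next
      assume "\<exists>y \<in> Z_loc p. x = 1 + (\<theta>\<^sub>2 - \<theta>\<^sub>1) * y"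
      then obtain y where "y \<in> Z_loc p" "x = 1 + (\<theta>\<^sub>2 - \<theta>\<^sub>1) * y" by blast
      thus "\<exists>y \<in> Z_loc p. x = 1 + of_nat p ^ (s div 2) * y"
        using u' by (intro bexI[of _ "of_int u * y"]) (simp_all add: u(1) mult.assoc)
    qed
    thus "carrier H = {x \<in> Units Z.K_ring. \<exists>y \<in> Z_loc p. x = 1 + (\<theta>\<^sub>2 - \<theta>\<^sub>1) * y}"
      unfolding H(1) by simp
  qed

  have part2': "class_iso_via (Z_loc_ring p) P Q (units_of (Z_loc_ring p))
          (\<lambda>a b. (a - b * \<theta>\<^sub>1) * inverse (a - b * \<theta>\<^sub>2))"
    if "\<not> quad_irreducible rat_ring P Q" "\<not> int p dvd P\<^sup>2 - 4 * Q"
  proof (rule split_Z[OF that(1)])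
    have "s = 0" using that(2) assms(6) by (cases s) auto
    moreover have "\<exists>y \<in> Z_loc p. x = 1 + y" if "x \<in> Z_loc p" for x
      using that by (intro bexI[of _ "x - 1"]) simp_all
    ultimately show "carrier (units_of (Z_loc_ring p)) =
        {x \<in> Units Z.K_ring. \<exists>y \<in> Z_loc p. x = 1 + of_nat p ^ (s div 2) * y}"
      by (auto simp: units_of_def Z_loc_ring_def Z.K_Units)
  qed (simp add: units_of_def Z_loc_ring_def)

  have part2'': "class_iso_via (Z_loc_ring p) P Q
          ((units_of (Z_loc_ring p))\<lparr>carrier := {1 + of_nat p ^ (s div 2) * x | x. x \<in> Z_loc p}\<rparr>)
          (\<lambda>a b. (a - b * \<theta>\<^sub>1) * inverse (a - b * \<theta>\<^sub>2))"
    if "\<not> quad_irreducible rat_ring P Q" "int p dvd P\<^sup>2 - 4 * Q"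
  proof (rule split_Z[OF that(1)])
    \<comment> \<open>Since \<open>p\<close> does not divide \<open>D\<^sub>0\<close>, divisibility
      of the discriminant forces \<open>s > 0\<close>. With \<open>s\<close> even, the exponent
      \<open>s div 2\<close> is positive, so all elements of the target are units.\<close>
    have "s \<noteq> 0" using that(2) assms(6,7) by (cases s) auto
    moreover have "even s" using valuation[OF that(1)] by blast
    ultimately have "s div 2 > 0" by auto
    thus "carrier ((units_of (Z_loc_ring p))\<lparr>carrier := {1 + of_nat p ^ (s div 2) * x | x. x \<in> Z_loc p}\<rparr>) =
        {x \<in> Units Z.K_ring. \<exists>y \<in> Z_loc p. x = 1 + of_nat p ^ (s div 2) * y}"
      using Units_Z_loc_one_plus[OF assms(4)] by auto
  qed (simp add: units_of_def Z_loc_ring_def)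

  have Q_unit_F: "[Q] \<cdot>\<^bsub>residue_field p\<^esub> \<one>\<^bsub>residue_field p\<^esub> \<in> Units (residue_field p)"
    using assms(5) p1 by (auto simp: residue_ring_int_multiple F.field_Units F.res_zero_eq dvd_eq_mod_eq_0)
  interpret FQ: quad_ring "residue_field p" P Q
    by unfold_locales (rule Q_unit_F)

  have part3: "class_iso_via (residue_field p) P Q
            (unit_quot L (generate_field L (insert \<alpha> (h ` carrier (residue_field p)))) (h ` carrier (residue_field p)))
            (\<lambda>a b. unit_coset L (generate_field L (insert \<alpha> (h ` carrier (residue_field p)))) (h ` carrier (residue_field p))
                     (h a \<ominus>\<^bsub>L\<^esub> h b \<otimes>\<^bsub>L\<^esub> \<alpha>))"
    if irr: "quad_irreducible (residue_field p) P Q" and L: "field L"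
      and h: "h \<in> ring_hom (residue_field p) L" and rts: "quad_roots L P Q \<alpha> \<beta>"
    for L :: "'l ring" and h \<alpha> \<beta>
  proof -
    interpret L: field L by fact
    interpret h: ring_hom_cring "residue_field p" L h by unfold_locales (rule h)
    note ab = L.quad_rootsD[OF rts]
    have rt: "\<alpha> \<otimes>\<^bsub>L\<^esub> \<alpha> = h FQ.P_ring \<otimes>\<^bsub>L\<^esub> \<alpha> \<ominus>\<^bsub>L\<^esub> h FQ.Q_ring"
      unfolding h.hom_int_multiple_one by (rule L.split_root(1)[OF ab])
    interpret E: quad_ext "residue_field p" P Q L h \<alpha>
    proof unfold_locales
      show "a = \<zero>\<^bsub>residue_field p\<^esub> \<and> b = \<zero>\<^bsub>residue_field p\<^esub>"
        if "a \<in> carrier (residue_field p)" "b \<in> carrier (residue_field p)"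
          "h a \<ominus>\<^bsub>L\<^esub> h b \<otimes>\<^bsub>L\<^esub> \<alpha> = \<zero>\<^bsub>L\<^esub>" for a b
        by (rule field_hom_lin_indep[OF F.is_field L h ab(1) FQ.P_ring_closed FQ.Q_ring_closed rt
              F.quad_irreducible_no_root[OF irr] that])
    qed (use h ab rt in auto)
    show ?thesis
      using E.class_iso_via_ext E.generate_field_eq_ext[OF F.is_field L] by simp
  qed

  have part3': "class_iso_via (residue_field p) P Q (units_of (residue_field p))
      (\<lambda>a b. (a \<ominus>\<^bsub>residue_field p\<^esub> b \<otimes>\<^bsub>residue_field p\<^esub> \<alpha>) \<otimes>\<^bsub>residue_field p\<^esub> inv\<^bsub>residue_field p\<^esub> (a \<ominus>\<^bsub>residue_field p\<^esub> b \<otimes>\<^bsub>residue_field p\<^esub> \<beta>))"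
    if D: "\<not> int p dvd P\<^sup>2 - 4 * Q" and rts: "quad_roots (residue_field p) P Q \<alpha> \<beta>" for \<alpha> \<beta>
  proof (rule FQ.class_iso_via_split)
    note ab = F.quad_rootsD[OF rts]
    show "\<alpha> \<in> carrier (residue_field p)" "\<beta> \<in> carrier (residue_field p)"
      "\<alpha> \<oplus>\<^bsub>residue_field p\<^esub> \<beta> = FQ.P_ring" "\<alpha> \<otimes>\<^bsub>residue_field p\<^esub> \<beta> = FQ.Q_ring" by (fact ab)+
    \<comment> \<open>A double root modulo \<open>p\<close> would give \<open>P = 2 \<alpha>\<close>
      and \<open>Q = \<alpha>^2\<close> there, hence a discriminant divisible by
      \<open>p\<close>.\<close>
    have "\<alpha> \<noteq> \<beta>"
    proof
      assume eq: "\<alpha> = \<beta>"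
      have "[\<alpha> + \<alpha> = P] (mod int p)" "[\<alpha> * \<alpha> = Q] (mod int p)"
        using ab(3,4) p1 unfolding eq residue_ring_int_multiple[OF p1]
        by (simp_all add: F.res_add_eq F.res_mult_eq cong_def)
      hence "[(\<alpha> + \<alpha>) ^ 2 - 4 * (\<alpha> * \<alpha>) = P\<^sup>2 - 4 * Q] (mod int p)"
        by (intro cong_diff cong_pow cong_mult cong_refl)
      moreover have "(\<alpha> + \<alpha>) ^ 2 - 4 * (\<alpha> * \<alpha>) = 0" by (simp add: power2_eq_square algebra_simps)
      ultimately have "[P\<^sup>2 - 4 * Q = 0] (mod int p)" by (simp add: cong_sym_eq)
      thus False using D by (simp add: cong_0_iff)
    qed
    hence "\<beta> \<ominus>\<^bsub>residue_field p\<^esub> \<alpha> \<noteq> \<zero>\<^bsub>residue_field p\<^esub>" using ab by auto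
    hence unit: "\<beta> \<ominus>\<^bsub>residue_field p\<^esub> \<alpha> \<in> Units (residue_field p)"
      using ab by (simp add: F.field_Units)
    show "x = \<zero>\<^bsub>residue_field p\<^esub>" if "x \<in> carrier (residue_field p)"
      "(\<beta> \<ominus>\<^bsub>residue_field p\<^esub> \<alpha>) \<otimes>\<^bsub>residue_field p\<^esub> x = \<zero>\<^bsub>residue_field p\<^esub>" for x
      using F.Units_l_cancel[OF unit that(1) F.zero_closed] that(2) unit by (simp add: F.Units_closed)
    show "carrier (units_of (residue_field p)) = {u \<in> Units (residue_field p). \<exists>x \<in> carrier (residue_field p).
        u = \<one>\<^bsub>residue_field p\<^esub> \<oplus>\<^bsub>residue_field p\<^esub> (\<beta> \<ominus>\<^bsub>residue_field p\<^esub> \<alpha>) \<otimes>\<^bsub>residue_field p\<^esub> x}"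
      using F.one_plus_unit_mult[OF unit] by (auto simp: units_of_def F.Units_closed)
  qed (simp add: units_of_def)

  have part3'': "class_iso_via (residue_field p) P Q (add_monoid (residue_field p))
      (\<lambda>a b. \<ominus>\<^bsub>residue_field p\<^esub> b \<otimes>\<^bsub>residue_field p\<^esub> inv\<^bsub>residue_field p\<^esub> (a \<ominus>\<^bsub>residue_field p\<^esub> b \<otimes>\<^bsub>residue_field p\<^esub> \<alpha>))"
    if "quad_roots (residue_field p) P Q \<alpha> \<alpha>" for \<alpha>
    using F.quad_rootsD[OF that] by (intro FQ.class_iso_via_double)

  show ?thesis
    by (intro conjI impI allI; (elim conjE)?;
        rule part1 part1' part2 part2' part2'' part3 part3' part3''; assumption)
qed

end
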